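(* Let $F:\mathbb{R}^n\rightrightarrows\mathbb{R}^n$ satisfy assumption (F), let $\mathcal{K}\subset\mathbb{R}^n$ be closed, and let $\mathcal{T}$ be the associated minimum time function. For any $x\in\mathcal{R}\setminus\mathcal{K}$, $$\dim N^P_{\mathcal{R}(\mathcal{T}(x))}(x)=\dim N^P_{\mathrm{epi}(\mathcal{T})}(x,\mathcal{T}(x)).$$
   Context: Assumption (F) on a multifunction $F:\mathbb{R}^n\rightrightarrows\mathbb{R}^n$: (F1) $F(x)$ is nonempty, convex and compact for each $x\in\mathbb{R}^n$; (F2) for each compact $Q\subset\mathbb{R}^n$ there is $L>0$ with $F(x)\subset F(y)+L|y-x|\bar{\mathbb{B}}$ for all $x,y\in Q$, where $\bar{\mathbb{B}}$ is the closed unit ball; (F3) there is $\gamma>0$ with $\max\{|v|:v\in F(x)\}\le\gamma(1+|x|)$ for all $x\in\mathbb{R}^n$. A trajectory of $F$ starting at $x$ is an absolutely continuous $x(\cdot)$ on $[0,T]$ with $\dot x(t)\in F(x(t))$ for a.e. $t$ and $x(0)=x$. The minimum time function $\mathcal{T}:\mathbb{R}^n\to[0,+\infty]$ associated with the closed target $\mathcal{K}$ is $\mathcal{T}(x)=0$ if $x\in\mathcal{K}$, and otherwise $\mathcal{T}(x)=\inf\{T>0:\text{there is a trajectory } x(\cdot) \text{ of } F \text{ with } x(0)=x,\ x(T)\in\mathcal{K}\}$, with $\inf\emptyset=+\infty$. The controllable set is $\mathcal{R}=\{x:\mathcal{T}(x)<+\infty\}$, and for $t\ge0$, $\mathcal{R}(t)=\{x:\mathcal{T}(x)\le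 t\}$ (so $\mathcal{R}(0)=\mathcal{K}$). For a closed set $E$ and $x\in E$, the proximal normal cone $N^P_E(x)$ is the set of $v$ for which there is $\sigma\ge0$ with $\langle v,y-x\rangle\le\sigma|y-x|^2$ for all $y\in E$. The epigraph is $\mathrm{epi}(\mathcal{T})=\{(x,\beta)\in\mathbb{R}^n\times\mathbb{R}:\mathcal{T}(x)<+\infty,\ \beta\ge\mathcal{T}(x)\}$. The dimension $\dim C$ of a cone $C$ is the maximal number of linearly independent vectors in $C$ (equivalently, the dimension of its linear span). *)

theory Defs
  imports "HOL-Analysis.Analysis"
begin

text \<open>
  The library has no absolute continuity for functions on an interval; this is the usual
  \<open>\<epsilon>\<close>-\<open>\<delta>\<close> definition. The finite families of
  non-overlapping subintervals of \<open>{a..b}\<close> are the divisions \<open>D\<close> of subsets of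
  \<open>{a..b}\<close>, and \<open>Inf I\<close>, \<open>Sup I\<close> are the endpoints of \<open>I \<in> D\<close>.
\<close>

definition abs_continuous_on_Icc :: "real \<Rightarrow> real \<Rightarrow> (real \<Rightarrow> 'a::real_normed_vector) \<Rightarrow> bool" where
  "abs_continuous_on_Icc a b f \<longleftrightarrow>
     (\<forall>\<epsilon>>0. \<exists>\<delta>>0. \<forall>D S. D division_of S \<and> S \<subseteq> {a..b} \<and> (\<Sum>I\<in>D. Sup I - Inf I) < \<delta>
        \<longrightarrow> (\<Sum>I\<in>D. norm (f (Sup I) - f (Inf I))) < \<epsilon>)"

text \<open>In the growth condition, the bound on the maximum of \<open>norm v\<close> over \<open>F x\<close>
  is written as a bound for every \<open>v \<in> F x\<close>.\<close>

definition assumption_F :: "('a::euclidean_space \<Rightarrow> 'a set) \<Rightarrow> bool" where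
  "assumption_F F \<longleftrightarrow>
     (\<forall>x. F x \<noteq> {} \<and> convex (F x) \<and> compact (F x)) \<and>
     (\<forall>Q. compact Q \<longrightarrow> (\<exists>L>0. \<forall>x\<in>Q. \<forall>y\<in>Q.
        F x \<subseteq> {w + (L * norm (y - x)) *\<^sub>R u | w u. w \<in> F y \<and> u \<in> cball 0 1})) \<and>
     (\<exists>\<gamma>>0. \<forall>x. \<forall>v\<in>F x. norm v \<le> \<gamma> * (1 + norm x))"

definition trajectory ::
  "('a::euclidean_space \<Rightarrow> 'a set) \<Rightarrow> 'a \<Rightarrow> real \<Rightarrow> (real \<Rightarrow> 'a) \<Rightarrow> bool" where
  "trajectory F x0 T x \<longleftrightarrow>
     abs_continuous_on_Icc 0 T x \<and>
     (AE t in lebesgue_on {0..T}. \<exists>v\<in>F (x t). (x has_vector_derivative v) (at t within {0..T})) \<and>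
     x 0 = x0"

text \<open>The infimum is taken in \<^typ>\<open>ereal\<close>, so it is \<open>\<infinity>\<close> over the empty set.\<close>

definition min_time :: "('a::euclidean_space \<Rightarrow> 'a set) \<Rightarrow> 'a set \<Rightarrow> 'a \<Rightarrow> ereal" where
  "min_time F K x =
     (if x \<in> K then 0
      else (INF T\<in>{T. 0 < T \<and> (\<exists>y. trajectory F x T y \<and> y T \<in> K)}. ereal T))"

definition controllable_set :: "('a::euclidean_space \<Rightarrow> 'a set) \<Rightarrow> 'a set \<Rightarrow> 'a set" where
  "controllable_set F K = {x. min_time F K x < \<infinity>}"

definition controllable_set_upto ::
  "('a::euclidean_space \<Rightarrow> 'a set) \<Rightarrow> 'a set \<Rightarrow> real \<Rightarrow> 'a set" where
  "controllable_set_upto F K t = {x. min_time F K x \<le> ereal t}"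

text \<open>Intended for closed \<open>E\<close> and \<open>x \<in> E\<close>; the formula itself is total.\<close>

definition proximal_normal_cone :: "'a::real_inner set \<Rightarrow> 'a \<Rightarrow> 'a set" where
  "proximal_normal_cone E x =
     {v. \<exists>\<sigma>\<ge>0. \<forall>y\<in>E. v \<bullet> (y - x) \<le> \<sigma> * (norm (y - x))\<^sup>2}"

text \<open>The library's \<^const>\<open>epigraph\<close> is for real-valued functions.\<close>

definition ereal_epigraph :: "('a \<Rightarrow> ereal) \<Rightarrow> ('a \<times> real) set" where
  "ereal_epigraph f = {(x, \<beta>). f x < \<infinity> \<and> f x \<le> ereal \<beta>}"

end

theory Submission
  imports Defs
begin

text \<open>
  Write \<open>h(\<zeta>) = min {\<zeta> \<bullet> v | v \<in> F x}\<close> and \<open>r = \<T>(x)\<close>. A pair \<open>(\<zeta>, \<mu>)\<close> is a proximal normal to the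
  epigraph at \<open>(x, r)\<close> exactly when \<open>\<zeta>\<close> is a proximal normal to the sublevel set at \<open>x\<close> and
  \<open>\<mu> = h(\<zeta>)\<close>: moving forwards along nearly optimal trajectories gives \<open>\<mu> \<ge> h(\<zeta>)\<close>, and moving
  backwards along a trajectory that arrives at \<open>x\<close> with a prescribed velocity \<open>v \<in> F x\<close> gives
  \<open>\<mu> \<le> \<zeta> \<bullet> v\<close>. So the projection to the first factor is a bijection between the two cones. As the
  normal cone of the epigraph is convex, the projection is even injective on its linear span, and
  the dimensions agree. Existence of optimal trajectories is not needed.
\<close>

section \<open>Absolutely continuous functions\<close>

text \<open>A proximal inequality tolerates \<open>\<sigma>\<close> times a squared distance, so
  displacements over a time \<open>s\<close> matter only up to errors of order
  \<open>s\<^sup>2\<close>. A surplus \<open>s\<^sup>2\<close> in the arrival time disappears in the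
  same term, which is how nearly optimal trajectories become good enough. The delicate input is the
  backward one: a straight line with velocity \<open>v \<in> F x\<close> is in general no
  trajectory, so a true one has to be built close to it. To lift normals from the sublevel set, this
  is required for every end point \<open>y\<close> near \<open>x\<close>, with an error of order
  \<open>s * (norm (y - x) + s)\<close>. Convexity of the values of \<open>F\<close> makes
  projections onto them continuous in time, so these velocities can be built as continuous functions
  and integrated. Arbitrary trajectories are merely absolutely continuous, with a velocity known
  almost everywhere. Quantitative information about them comes from one scalar fact: a function with
  derivative at least \<open>c\<close> almost everywhere grows at least at rate \<open>c\<close>. It
  is obtained directly from tagged divisions.\<close>

lemma abs_continuous_subinterval_sums:
  assumes "abs_continuous_on_Icc a b f" "\<epsilon> > 0"
  obtains \<delta> where "\<delta> > 0"
    "\<And>p s. \<lbrakk>p tagged_partial_division_of s; s \<subseteq> {a..b}; (\<Sum>(t,I)\<in>p. Sup I - Inf I) < \<delta>\<rbrakk>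
      \<Longrightarrow> (\<Sum>(t,I)\<in>p. norm (f (Sup I) - f (Inf I))) < \<epsilon>"
proof -
  obtain \<delta> where "\<delta> > 0" and \<delta>:
    "\<And>D S. \<lbrakk>D division_of S; S \<subseteq> {a..b}; (\<Sum>I\<in>D. Sup I - Inf I) < \<delta>\<rbrakk>
      \<Longrightarrow> (\<Sum>I\<in>D. norm (f (Sup I) - f (Inf I))) < \<epsilon>"
    using assms unfolding abs_continuous_on_Icc_def by metis
  have "(\<Sum>(t,I)\<in>p. norm (f (Sup I) - f (Inf I))) < \<epsilon>"
    if p: "p tagged_partial_division_of s" and s: "s \<subseteq> {a..b}"
      and len: "(\<Sum>(t,I)\<in>p. Sup I - Inf I) < \<delta>" for p s
  proof -
    have nonempty: "I \<noteq> {}" if "(t, I) \<in> p" for t I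
      using tagged_partial_division_ofD(2)[OF p that] by auto
    have collapse: "(\<Sum>(t,I)\<in>p. d I) = sum d (snd ` p)"
      if d: "\<And>u. d {u} = 0" for d :: "real set \<Rightarrow> real"
    proof -
      \<comment> \<open>The library lemma asks for the value 0 on every \<open>cbox u v\<close> with
        empty interior, the empty set included, where nothing is known about \<open>d\<close>.
        Overwriting \<open>d {}\<close> is harmless because each interval in \<open>p\<close>
        contains its tag.\<close>
      let ?d = "\<lambda>I. if I = {} then 0 else d I"
      have "(\<Sum>(t,I)\<in>p. ?d I) = sum ?d (snd ` p)"
      proof (rule sum.over_tagged_division_lemma[OF tagged_partial_division_of_Union_self[OF p]])
        fix u v :: real assume "box u v = {}"
        then have "v \<le> u" by simp
        then show "?d (cbox u v) = 0"
          using d by (cases "u = v") auto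
      qed
      moreover have "(\<Sum>(t,I)\<in>p. ?d I) = (\<Sum>(t,I)\<in>p. d I)"
        by (rule sum.cong) (use nonempty in auto)
      moreover have "sum ?d (snd ` p) = sum d (snd ` p)"
        by (rule sum.cong) (use nonempty in auto)
      ultimately show ?thesis by simp
    qed
    have "snd ` p division_of \<Union>(snd ` p)"
      using partial_division_of_tagged_division[OF p] .
    moreover have "\<Union>(snd ` p) \<subseteq> {a..b}"
      using tagged_partial_division_ofD(3)[OF p] s by fastforce
    moreover have "(\<Sum>I\<in>snd ` p. Sup I - Inf I) < \<delta>"
      using collapse[of "\<lambda>I. Sup I - Inf I"] len by simp
    ultimately have "(\<Sum>I\<in>snd ` p. norm (f (Sup I) - f (Inf I))) < \<epsilon>"
      by (rule \<delta>)
    then show ?thesis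
      using collapse[of "\<lambda>I. norm (f (Sup I) - f (Inf I))"] by simp
  qed
  with \<open>\<delta> > 0\<close> show thesis by (rule that)
qed

text \<open>As \<open>u\<close> and \<open>v\<close> lie on opposite sides of \<open>t\<close>, the
  errors \<open>(d - c) * \<bar>u - t\<bar>\<close> and \<open>(d - c) * \<bar>v - t\<bar>\<close>
  of the linear approximation add up to exactly \<open>(d - c) * (v - u)\<close>, the available
  slack.\<close>

lemma straddle_lower_bound:
  fixes g :: "real \<Rightarrow> real"
  assumes "(g has_vector_derivative d) (at t)" "c < d"
  obtains r where "r > 0"
    "\<And>u v. \<lbrakk>u \<le> t; t \<le> v; u \<in> ball t r; v \<in> ball t r\<rbrakk> \<Longrightarrow> c * (v - u) \<le> g v - g u"
proof -
  have "\<forall>e>0. \<exists>r>0. \<forall>y. \<bar>y - t\<bar> < r \<longrightarrow> \<bar>g y - g t - (y - t) * d\<bar> \<le> e * \<bar>y - t\<bar>"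
    using assms(1) unfolding has_vector_derivative_def has_derivative_at_alt by simp
  moreover have "d - c > 0" using assms(2) by simp
  ultimately obtain r where "r > 0"
    and r: "\<And>y. \<bar>y - t\<bar> < r \<Longrightarrow> \<bar>g y - g t - (y - t) * d\<bar> \<le> (d - c) * \<bar>y - t\<bar>"
    by meson
  show thesis
  proof (rule that[OF \<open>r > 0\<close>])
    fix u v assume "u \<le> t" "t \<le> v" "u \<in> ball t r" "v \<in> ball t r"
    then show "c * (v - u) \<le> g v - g u"
      using r[of u] r[of v] by (auto simp: dist_real_def algebra_simps)
  qed
qed

text \<open>On a fine tagged division, the intervals tagged outside \<open>N\<close> are controlled by the derivative, and
  those tagged in \<open>N\<close> have small total length, so absolute continuity controls their contribution.\<close>

lemma abs_continuous_growth:
  fixes g :: "real \<Rightarrow> real"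
  assumes AC: "abs_continuous_on_Icc a b g" and "a \<le> b" and N: "negligible N"
    and deriv: "\<And>t. t \<in> {a..b} - N \<Longrightarrow> \<exists>d\<ge>c. (g has_vector_derivative d) (at t)"
  shows "c * (b - a) \<le> g b - g a"
proof (rule field_le_epsilon)
  fix e :: real assume "e > 0"
  \<comment> \<open>\<open>e\<close> is spent in thirds: on lowering \<open>c\<close> to
    \<open>c'\<close>, on the increments of \<open>g\<close> over intervals tagged in
    \<open>N\<close>, and on \<open>c'\<close> times the length of those intervals. The
    \<open>+ 1\<close> keeps the denominator positive when \<open>a = b\<close>.\<close>
  define c' where "c' = c - e / (3 * (b - a + 1))"
  have "c' < c" and c': "(c - c') * (b - a) \<le> e / 3"
    using \<open>a \<le> b\<close> \<open>e > 0\<close> by (auto simp: c'_def field_simps)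
  obtain \<delta> where "\<delta> > 0" and \<delta>:
    "\<And>p s. \<lbrakk>p tagged_partial_division_of s; s \<subseteq> {a..b}; (\<Sum>(t,I)\<in>p. Sup I - Inf I) < \<delta>\<rbrakk>
      \<Longrightarrow> (\<Sum>(t,I)\<in>p. norm (g (Sup I) - g (Inf I))) < e / 3"
    using abs_continuous_subinterval_sums[OF AC, of "e / 3"] \<open>e > 0\<close> by auto
  define k where "k = \<bar>c'\<bar> + 1"
  have "k > 0" "\<bar>c'\<bar> \<le> k" by (auto simp: k_def)
  define \<delta>' where "\<delta>' = min \<delta> (e / (3 * k))"
  have "\<delta>' > 0" using \<open>\<delta> > 0\<close> \<open>e > 0\<close> \<open>k > 0\<close> by (auto simp: \<delta>'_def)
  \<comment> \<open>On a division the Riemann sum of this indicator is the total length of the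
    intervals tagged in \<open>N\<close>, so integral 0 makes that length small on fine
    divisions.\<close>
  have "(indicat_real N has_integral 0) {a..b}"
    using N unfolding negligible_def by (metis box_real(2))
  then have "\<exists>\<gamma>. gauge \<gamma> \<and> (\<forall>p. p tagged_division_of {a..b} \<and> \<gamma> fine p \<longrightarrow>
      norm ((\<Sum>(t,I)\<in>p. measure lborel I *\<^sub>R indicat_real N t) - 0) < \<delta>')"
    using \<open>\<delta>' > 0\<close> unfolding has_integral_real by metis
  then obtain \<gamma> where "gauge \<gamma>" and \<gamma>: "\<And>p. p tagged_division_of {a..b} \<Longrightarrow> \<gamma> fine p \<Longrightarrow>
      norm ((\<Sum>(t,I)\<in>p. measure lborel I *\<^sub>R indicat_real N t) - 0) < \<delta>'"
    by auto
  have "\<exists>r>0. t \<in> {a..b} - N \<longrightarrow> (\<forall>u v. u \<le> t \<longrightarrow> t \<le> v \<longrightarrow> u \<in> ball t r \<longrightarrow> v \<in> ball t r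
      \<longrightarrow> c' * (v - u) \<le> g v - g u)" for t
  proof (cases "t \<in> {a..b} - N")
    case True
    then obtain d where "(g has_vector_derivative d) (at t)" "c' < d"
      using deriv \<open>c' < c\<close> by fastforce
    then show ?thesis by (meson straddle_lower_bound)
  qed (auto intro: exI[of _ 1])
  then obtain r where r: "\<And>t. r t > 0" "\<And>t u v. \<lbrakk>t \<in> {a..b} - N; u \<le> t; t \<le> v; u \<in> ball t (r t); v \<in> ball t (r t)\<rbrakk>
      \<Longrightarrow> c' * (v - u) \<le> g v - g u"
    by metis
  have fine_gauge: "gauge (\<lambda>t. \<gamma> t \<inter> ball t (r t))"
    by (intro gauge_Int gauge_ball_dependent \<open>gauge \<gamma>\<close>) (simp add: r(1))
  obtain p where p: "p tagged_division_of {a..b}" and fine: "(\<lambda>t. \<gamma> t \<inter> ball t (r t)) fine p"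
    using fine_division_exists_real[OF fine_gauge, of a b] by metis
  then have p': "p tagged_partial_division_of {a..b}" and "finite p"
    by (simp_all add: tagged_division_of_def tagged_partial_division_of_def)
  have I: "\<exists>u v. I = {u..v} \<and> u \<le> t \<and> t \<le> v \<and> I \<subseteq> ball t (r t) \<and> t \<in> {a..b}" if "(t, I) \<in> p" for t I
    using tagged_division_ofD(2,3,4)[OF p that] fineD[OF fine that] by fastforce
  define q where "q = {(t,I) \<in> p. t \<in> N}"
  have "q \<subseteq> p" by (auto simp: q_def)
  have q: "q tagged_partial_division_of {a..b}"
    using tagged_partial_division_subset[OF p' \<open>q \<subseteq> p\<close>] .
  have "(\<Sum>(t,I)\<in>q. Sup I - Inf I) = (\<Sum>(t,I)\<in>q. measure lborel I *\<^sub>R indicat_real N t)"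
    by (rule sum.cong) (use I in \<open>force simp: q_def\<close>)+
  also have "\<dots> = (\<Sum>(t,I)\<in>p. measure lborel I *\<^sub>R indicat_real N t)"
    by (rule sum.mono_neutral_left) (use \<open>finite p\<close> in \<open>auto simp: q_def indicator_def split: if_splits\<close>)
  also have "\<dots> < \<delta>'"
    using \<gamma>[OF p] fine by (auto simp: fine_Int)
  finally have len: "(\<Sum>(t,I)\<in>q. Sup I - Inf I) < \<delta>'" .
  have len0: "0 \<le> (\<Sum>(t,I)\<in>q. Sup I - Inf I)"
    by (rule sum_nonneg) (use I \<open>q \<subseteq> p\<close> in fastforce)
  have gq: "(\<Sum>(t,I)\<in>q. norm (g (Sup I) - g (Inf I))) < e / 3"
    using \<delta>[OF q] len by (simp add: \<delta>'_def)
  have cq: "\<bar>c'\<bar> * (\<Sum>(t,I)\<in>q. Sup I - Inf I) \<le> e / 3"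
  proof -
    have "\<bar>c'\<bar> * (\<Sum>(t,I)\<in>q. Sup I - Inf I) \<le> k * (e / (3 * k))"
      by (intro mult_mono) (use len len0 \<open>k > 0\<close> \<open>\<bar>c'\<bar> \<le> k\<close> in \<open>auto simp: \<delta>'_def\<close>)
    then show ?thesis using \<open>k > 0\<close> by simp
  qed
  have "(\<Sum>(t,I)\<in>p. g (Sup I) - g (Inf I)) - c' * (\<Sum>(t,I)\<in>p. Sup I - Inf I)
      = (\<Sum>(t,I)\<in>p. g (Sup I) - g (Inf I) - c' * (Sup I - Inf I))"
    by (simp add: sum_distrib_left sum_subtractf case_prod_unfold right_diff_distrib)
  also have "\<dots> \<ge> (\<Sum>(t,I)\<in>q. g (Sup I) - g (Inf I) - c' * (Sup I - Inf I))"
  proof (rule sum_mono2[OF \<open>finite p\<close> \<open>q \<subseteq> p\<close>], clarify)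
    fix t I assume t: "(t, I) \<in> p" "(t, I) \<notin> q"
    then obtain u v where uv: "I = {u..v}" "u \<le> t" "t \<le> v" "I \<subseteq> ball t (r t)" "t \<in> {a..b}"
      using I by blast
    have "u \<in> ball t (r t)" "v \<in> ball t (r t)"
      using uv(1-3) subsetD[OF uv(4), of u] subsetD[OF uv(4), of v] by simp_all
    with t uv show "0 \<le> g (Sup I) - g (Inf I) - c' * (Sup I - Inf I)"
      using r(2)[of t u v] by (auto simp: q_def)
  qed
  also have "(\<Sum>(t,I)\<in>q. g (Sup I) - g (Inf I) - c' * (Sup I - Inf I))
      = (\<Sum>(t,I)\<in>q. g (Sup I) - g (Inf I)) - c' * (\<Sum>(t,I)\<in>q. Sup I - Inf I)"
    by (simp add: sum_distrib_left sum_subtractf case_prod_unfold right_diff_distrib)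
  also have "\<dots> \<ge> - (\<Sum>(t,I)\<in>q. norm (g (Sup I) - g (Inf I))) - \<bar>c'\<bar> * (\<Sum>(t,I)\<in>q. Sup I - Inf I)"
  proof -
    have "norm (\<Sum>(t,I)\<in>q. g (Sup I) - g (Inf I)) \<le> (\<Sum>(t,I)\<in>q. norm (g (Sup I) - g (Inf I)))"
      using norm_sum[of "\<lambda>(t,I). g (Sup I) - g (Inf I)" q] by (simp add: case_prod_unfold)
    moreover have "c' * (\<Sum>(t,I)\<in>q. Sup I - Inf I) \<le> \<bar>c'\<bar> * (\<Sum>(t,I)\<in>q. Sup I - Inf I)"
      using len0 by (intro mult_right_mono) auto
    ultimately show ?thesis by (simp add: abs_le_iff)
  qed
  finally have "- (2 * e / 3) \<le> (g b - g a) - c' * (b - a)"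
    using gq cq additive_tagged_division_1[OF \<open>a \<le> b\<close> p, of g]
      additive_tagged_division_1[OF \<open>a \<le> b\<close> p, of "\<lambda>x. x"] by simp
  then show "c * (b - a) \<le> g b - g a + e"
    using c' by (simp add: algebra_simps)
qed

section \<open>Operations that preserve absolute continuity\<close>

text \<open>A monotone 1-Lipschitz change of time sends non-overlapping intervals to non-overlapping
  ones that are no longer, so the same \<open>\<delta>\<close> works. Besides restrictions and
  shifts this covers the clamped times \<open>min t S\<close> and \<open>max (t - S) 0\<close> of a
  concatenation.\<close>

lemma abs_continuous_compose_mono:
  assumes AC: "abs_continuous_on_Icc a b f"
    and \<phi>: "\<And>t. t \<in> {c..d} \<Longrightarrow> \<phi> t \<in> {a..b}"
      "\<And>u v. \<lbrakk>c \<le> u; u \<le> v; v \<le> d\<rbrakk> \<Longrightarrow> \<phi> u \<le> \<phi> v"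
      "\<And>u v. \<lbrakk>c \<le> u; u \<le> v; v \<le> d\<rbrakk> \<Longrightarrow> \<phi> v - \<phi> u \<le> v - u"
  shows "abs_continuous_on_Icc c d (\<lambda>t. f (\<phi> t))"
  unfolding abs_continuous_on_Icc_def
proof (intro allI impI)
  fix \<epsilon> :: real assume "\<epsilon> > 0"
  then obtain \<delta> where "\<delta> > 0" and \<delta>:
    "\<And>p s. \<lbrakk>p tagged_partial_division_of s; s \<subseteq> {a..b}; (\<Sum>(t,I)\<in>p. Sup I - Inf I) < \<delta>\<rbrakk>
      \<Longrightarrow> (\<Sum>(t,I)\<in>p. norm (f (Sup I) - f (Inf I))) < \<epsilon>"
    using abs_continuous_subinterval_sums[OF AC, of \<epsilon>] by auto
  have "(\<Sum>I\<in>D. norm (f (\<phi> (Sup I)) - f (\<phi> (Inf I)))) < \<epsilon>"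
    if D: "D division_of S" and S: "S \<subseteq> {c..d}" and len: "(\<Sum>I\<in>D. Sup I - Inf I) < \<delta>" for D S
  proof -
    have I: "\<exists>u v. I = {u..v} \<and> c \<le> u \<and> u \<le> v \<and> v \<le> d" if "I \<in> D" for I
      using division_ofD(2,3,4)[OF D that] S by fastforce
    let ?J = "\<lambda>I. {\<phi> (Inf I)..\<phi> (Sup I)}"
    \<comment> \<open>Intervals that \<open>\<phi>\<close> collapses to a point contribute nothing,
      but several may have the same image; discarding them makes the passage to images
      injective.\<close>
    define D' where "D' = {I \<in> D. \<phi> (Inf I) < \<phi> (Sup I)}"
    define p where "p = (\<lambda>I. (\<phi> (Inf I), ?J I)) ` D'"
    have "finite D" using D by auto
    then have "finite D'" by (simp add: D'_def)
    have sep: "{\<phi> (Inf I)<..<\<phi> (Sup I)} \<inter> {\<phi> (Inf J)<..<\<phi> (Sup J)} = {}"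
      if "I \<in> D'" "J \<in> D'" "I \<noteq> J" for I J
    proof -
      have "I \<in> D" "J \<in> D" using that by (auto simp: D'_def)
      obtain u v where uv: "I = {u..v}" "c \<le> u" "u \<le> v" "v \<le> d"
        using I[OF \<open>I \<in> D\<close>] by blast
      obtain u' v' where uv': "J = {u'..v'}" "c \<le> u'" "u' \<le> v'" "v' \<le> d"
        using I[OF \<open>J \<in> D\<close>] by blast
      have lt: "u < v" "u' < v'"
        using that uv uv' by (auto simp: D'_def order_le_less)
      have "interior I \<inter> interior J = {}"
        using division_ofD(5)[OF D] that by (auto simp: D'_def)
      then have "{u<..<v} \<inter> {u'<..<v'} = {}"
        using uv uv' by simp
      then have "v \<le> u' \<or> v' \<le> u"
        using lt dense[of "max u u'" "min v v'"] by fastforce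
      then have "\<phi> v \<le> \<phi> u' \<or> \<phi> v' \<le> \<phi> u"
        using \<phi>(2)[of v u'] \<phi>(2)[of v' u] uv uv' by auto
      then show ?thesis using uv uv' by auto
    qed
    have inj: "inj_on (\<lambda>I. (\<phi> (Inf I), ?J I)) D'"
    proof (rule inj_onI, rule ccontr)
      fix I J assume IJ: "I \<in> D'" "J \<in> D'" "(\<phi> (Inf I), ?J I) = (\<phi> (Inf J), ?J J)" "I \<noteq> J"
      then have "\<phi> (Inf I) < \<phi> (Sup I)" "\<phi> (Sup I) = \<phi> (Sup J)" "\<phi> (Inf I) = \<phi> (Inf J)"
        by (auto simp: D'_def)
      then show False using sep[OF IJ(1,2,4)] by (simp add: greaterThanLessThan_empty_iff)
    qed
    have "p tagged_partial_division_of {a..b}"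
      unfolding tagged_partial_division_of_def
    proof (intro conjI allI impI)
      show "finite p" using \<open>finite D'\<close> by (simp add: p_def)
      fix t J assume "(t, J) \<in> p"
      then obtain I where I': "I \<in> D" "t = \<phi> (Inf I)" "J = ?J I"
        by (auto simp: p_def D'_def)
      obtain u v where "I = {u..v}" "c \<le> u" "u \<le> v" "v \<le> d"
        using I[OF I'(1)] by blast
      then show "t \<in> J" "J \<subseteq> {a..b}" "\<exists>u v. J = cbox u v"
        using \<phi>(1)[of u] \<phi>(1)[of v] \<phi>(2)[of u v] I' by auto
    next
      fix t J t' J' assume "(t, J) \<in> p \<and> (t', J') \<in> p \<and> (t, J) \<noteq> (t', J')"
      then obtain I I' where "I \<in> D'" "I' \<in> D'" "I \<noteq> I'" "J = ?J I" "J' = ?J I'"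
        by (auto simp: p_def)
      then show "interior J \<inter> interior J' = {}"
        using sep by simp
    qed
    moreover have "(\<Sum>(t,I)\<in>p. Sup I - Inf I) < \<delta>"
    proof -
      have "(\<Sum>(t,I)\<in>p. Sup I - Inf I) = (\<Sum>I\<in>D'. \<phi> (Sup I) - \<phi> (Inf I))"
        unfolding p_def sum.reindex[OF inj] by (intro sum.cong) (auto simp: D'_def)
      also have "\<dots> \<le> (\<Sum>I\<in>D'. Sup I - Inf I)"
        by (intro sum_mono) (use I \<phi>(3) in \<open>fastforce simp: D'_def\<close>)
      also have "\<dots> \<le> (\<Sum>I\<in>D. Sup I - Inf I)"
        by (intro sum_mono2 \<open>finite D\<close>) (use I in \<open>fastforce simp: D'_def\<close>)+
      finally show ?thesis using len by simp
    qed
    ultimately have "(\<Sum>(t,I)\<in>p. norm (f (Sup I) - f (Inf I))) < \<epsilon>"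
      by (intro \<delta>) auto
    also have "(\<Sum>(t,I)\<in>p. norm (f (Sup I) - f (Inf I))) = (\<Sum>I\<in>D'. norm (f (\<phi> (Sup I)) - f (\<phi> (Inf I))))"
      unfolding p_def sum.reindex[OF inj] by (intro sum.cong) (auto simp: D'_def)
    also have "\<dots> = (\<Sum>I\<in>D. norm (f (\<phi> (Sup I)) - f (\<phi> (Inf I))))"
    proof (rule sum.mono_neutral_left)
      show "\<forall>I\<in>D - D'. norm (f (\<phi> (Sup I)) - f (\<phi> (Inf I))) = 0"
      proof
        fix J assume J: "J \<in> D - D'"
        then obtain u v where "J = {u..v}" "c \<le> u" "u \<le> v" "v \<le> d"
          using I by blast
        then show "norm (f (\<phi> (Sup J)) - f (\<phi> (Inf J))) = 0"
          using J \<phi>(2)[of u v] by (auto simp: D'_def)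
      qed
    qed (use \<open>finite D\<close> in \<open>auto simp: D'_def\<close>)
    finally show ?thesis .
  qed
  with \<open>\<delta> > 0\<close> show "\<exists>\<delta>>0. \<forall>D S. D division_of S \<and> S \<subseteq> {c..d} \<and> (\<Sum>I\<in>D. Sup I - Inf I) < \<delta>
      \<longrightarrow> (\<Sum>I\<in>D. norm (f (\<phi> (Sup I)) - f (\<phi> (Inf I)))) < \<epsilon>"
    by (intro exI[of _ \<delta>]) auto
qed

lemma abs_continuous_lipschitz:
  assumes lip: "\<And>u v. \<lbrakk>a \<le> u; u \<le> v; v \<le> b\<rbrakk> \<Longrightarrow> norm (f v - f u) \<le> M * (v - u)"
  shows "abs_continuous_on_Icc a b f"
  unfolding abs_continuous_on_Icc_def
proof (intro allI impI)
  fix \<epsilon> :: real assume "\<epsilon> > 0"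
  have "(\<Sum>I\<in>D. norm (f (Sup I) - f (Inf I))) < \<epsilon>"
    if D: "D division_of S" and S: "S \<subseteq> {a..b}" and len: "(\<Sum>I\<in>D. Sup I - Inf I) < \<epsilon> / (\<bar>M\<bar> + 1)" for D S
  proof -
    have I: "\<exists>u v. I = {u..v} \<and> a \<le> u \<and> u \<le> v \<and> v \<le> b" if "I \<in> D" for I
      using division_ofD(2,3,4)[OF D that] S by fastforce
    have "(\<Sum>I\<in>D. norm (f (Sup I) - f (Inf I))) \<le> (\<Sum>I\<in>D. (\<bar>M\<bar> + 1) * (Sup I - Inf I))"
    proof (rule sum_mono)
      fix J assume "J \<in> D"
      then obtain u v where uv: "J = {u..v}" "a \<le> u" "u \<le> v" "v \<le> b" using I by blast
      then have "M * (v - u) \<le> (\<bar>M\<bar> + 1) * (v - u)" by (intro mult_right_mono) auto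
      then show "norm (f (Sup J) - f (Inf J)) \<le> (\<bar>M\<bar> + 1) * (Sup J - Inf J)"
        using lip[of u v] uv by simp
    qed
    also have "\<dots> < \<epsilon>"
      using len by (simp add: sum_distrib_left[symmetric] pos_less_divide_eq mult.commute)
    finally show ?thesis .
  qed
  with \<open>\<epsilon> > 0\<close> show "\<exists>\<delta>>0. \<forall>D S. D division_of S \<and> S \<subseteq> {a..b} \<and> (\<Sum>I\<in>D. Sup I - Inf I) < \<delta>
      \<longrightarrow> (\<Sum>I\<in>D. norm (f (Sup I) - f (Inf I))) < \<epsilon>"
    by (intro exI[of _ "\<epsilon> / (\<bar>M\<bar> + 1)"]) auto
qed

lemma abs_continuous_add:
  assumes "abs_continuous_on_Icc a b f" "abs_continuous_on_Icc a b g"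
  shows "abs_continuous_on_Icc a b (\<lambda>t. f t + g t)"
  unfolding abs_continuous_on_Icc_def
proof (intro allI impI)
  fix \<epsilon> :: real assume "\<epsilon> > 0"
  then have "\<epsilon> / 2 > 0" by simp
  obtain \<delta> where "\<delta> > 0" and \<delta>:
    "\<And>D S. \<lbrakk>D division_of S; S \<subseteq> {a..b}; (\<Sum>I\<in>D. Sup I - Inf I) < \<delta>\<rbrakk>
        \<Longrightarrow> (\<Sum>I\<in>D. norm (f (Sup I) - f (Inf I))) < \<epsilon> / 2"
    using assms(1) \<open>\<epsilon> / 2 > 0\<close> unfolding abs_continuous_on_Icc_def by metis
  obtain \<delta>' where "\<delta>' > 0" and \<delta>':
    "\<And>D S. \<lbrakk>D division_of S; S \<subseteq> {a..b}; (\<Sum>I\<in>D. Sup I - Inf I) < \<delta>'\<rbrakk>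
        \<Longrightarrow> (\<Sum>I\<in>D. norm (g (Sup I) - g (Inf I))) < \<epsilon> / 2"
    using assms(2) \<open>\<epsilon> / 2 > 0\<close> unfolding abs_continuous_on_Icc_def by metis
  show "\<exists>\<delta>>0. \<forall>D S. D division_of S \<and> S \<subseteq> {a..b} \<and> (\<Sum>I\<in>D. Sup I - Inf I) < \<delta>
      \<longrightarrow> (\<Sum>I\<in>D. norm (f (Sup I) + g (Sup I) - (f (Inf I) + g (Inf I)))) < \<epsilon>"
  proof (intro exI[of _ "min \<delta> \<delta>'"] conjI allI impI; (elim conjE)?)
    fix D S assume D: "D division_of S" "S \<subseteq> {a..b}" "(\<Sum>I\<in>D. Sup I - Inf I) < min \<delta> \<delta>'"
    have "(\<Sum>I\<in>D. norm (f (Sup I) + g (Sup I) - (f (Inf I) + g (Inf I))))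
      \<le> (\<Sum>I\<in>D. norm (f (Sup I) - f (Inf I)) + norm (g (Sup I) - g (Inf I)))"
      by (intro sum_mono norm_diff_triangle_ineq)
    then show "(\<Sum>I\<in>D. norm (f (Sup I) + g (Sup I) - (f (Inf I) + g (Inf I)))) < \<epsilon>"
      using \<delta>[OF D(1,2)] \<delta>'[OF D(1,2)] D(3) by (simp add: sum.distrib)
  qed (use \<open>\<delta> > 0\<close> \<open>\<delta>' > 0\<close> in simp)
qed

lemma abs_continuous_inner:
  assumes "abs_continuous_on_Icc a b f"
  shows "abs_continuous_on_Icc a b (\<lambda>t. w \<bullet> f t)"
  unfolding abs_continuous_on_Icc_def
proof (intro allI impI)
  fix \<epsilon> :: real assume "\<epsilon> > 0"
  then have "\<epsilon> / (norm w + 1) > 0" by (simp add: add_nonneg_pos)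
  then obtain \<delta> where pos: "\<delta> > 0" and \<delta>:
    "\<And>D S. \<lbrakk>D division_of S; S \<subseteq> {a..b}; (\<Sum>I\<in>D. Sup I - Inf I) < \<delta>\<rbrakk>
        \<Longrightarrow> (\<Sum>I\<in>D. norm (f (Sup I) - f (Inf I))) < \<epsilon> / (norm w + 1)"
    using assms unfolding abs_continuous_on_Icc_def by metis
  show "\<exists>\<delta>>0. \<forall>D S. D division_of S \<and> S \<subseteq> {a..b} \<and> (\<Sum>I\<in>D. Sup I - Inf I) < \<delta>
      \<longrightarrow> (\<Sum>I\<in>D. norm (w \<bullet> f (Sup I) - w \<bullet> f (Inf I))) < \<epsilon>"
  proof (intro exI[of _ \<delta>] conjI allI impI; (elim conjE)?)
    fix D S assume D: "D division_of S" "S \<subseteq> {a..b}" "(\<Sum>I\<in>D. Sup I - Inf I) < \<delta>"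
    have "(\<Sum>I\<in>D. norm (w \<bullet> f (Sup I) - w \<bullet> f (Inf I)))
      \<le> (\<Sum>I\<in>D. (norm w + 1) * norm (f (Sup I) - f (Inf I)))"
    proof (rule sum_mono)
      fix I
      have "\<bar>w \<bullet> (f (Sup I) - f (Inf I))\<bar> \<le> norm w * norm (f (Sup I) - f (Inf I))"
        by (rule Cauchy_Schwarz_ineq2)
      also have "\<dots> \<le> (norm w + 1) * norm (f (Sup I) - f (Inf I))"
        by (intro mult_right_mono) auto
      finally show "norm (w \<bullet> f (Sup I) - w \<bullet> f (Inf I)) \<le> (norm w + 1) * norm (f (Sup I) - f (Inf I))"
        by (simp add: inner_diff_right)
    qed
    then show "(\<Sum>I\<in>D. norm (w \<bullet> f (Sup I) - w \<bullet> f (Inf I))) < \<epsilon>"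
      using \<delta>[OF D] by (simp add: sum_distrib_left[symmetric] pos_less_divide_eq add_nonneg_pos mult.commute)
  qed (use pos in simp)
qed

lemma abs_continuous_imp_continuous_on:
  assumes "abs_continuous_on_Icc a b f"
  shows "continuous_on {a..b} f"
  unfolding continuous_on_iff
proof (intro ballI allI impI)
  fix s \<epsilon> :: real assume s: "s \<in> {a..b}" and "\<epsilon> > 0"
  then obtain \<delta> where pos: "\<delta> > 0" and \<delta>:
    "\<And>D S. \<lbrakk>D division_of S; S \<subseteq> {a..b}; (\<Sum>I\<in>D. Sup I - Inf I) < \<delta>\<rbrakk>
        \<Longrightarrow> (\<Sum>I\<in>D. norm (f (Sup I) - f (Inf I))) < \<epsilon>"
    using assms unfolding abs_continuous_on_Icc_def by metis
  have close: "norm (f v - f u) < \<epsilon>" if "a \<le> u" "u \<le> v" "v \<le> b" "v - u < \<delta>" for u v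
    using \<delta>[of "{{u..v}}" "{u..v}"] division_of_self[of u v] that by simp
  show "\<exists>\<delta>>0. \<forall>t\<in>{a..b}. dist t s < \<delta> \<longrightarrow> dist (f t) (f s) < \<epsilon>"
  proof (intro exI[of _ \<delta>] conjI ballI impI)
    fix t assume "t \<in> {a..b}" "dist t s < \<delta>"
    then show "dist (f t) (f s) < \<epsilon>"
      using close[of t s] close[of s t] s
      by (cases "t \<le> s") (auto simp: dist_norm norm_minus_commute)
  qed (fact pos)
qed

section \<open>Trajectories and the minimum time function\<close>

text \<open>At interior times the derivative within \<open>{0..T}\<close> is the full derivative,
  and the end points form a null set. An explicit exceptional set is easy to carry through shifts
  and concatenations.\<close>

lemma trajectory_iff:
  "trajectory F x0 T y \<longleftrightarrow>
     abs_continuous_on_Icc 0 T y \<and>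
     (\<exists>N. negligible N \<and> (\<forall>t\<in>{0<..<T} - N. \<exists>v\<in>F (y t). (y has_vector_derivative v) (at t))) \<and>
     y 0 = x0"
proof -
  have at: "at t within {0..T} = at t" if "t \<in> {0<..<T}" for t
    using that by (intro at_within_interior) simp
  have "(AE t in lebesgue_on {0..T}. \<exists>v\<in>F (y t). (y has_vector_derivative v) (at t within {0..T}))
    \<longleftrightarrow> (\<exists>N. negligible N \<and> (\<forall>t\<in>{0<..<T} - N. \<exists>v\<in>F (y t). (y has_vector_derivative v) (at t)))"
    (is "?AE \<longleftrightarrow> ?N")
  proof
    assume ?AE
    then have "AE t in lebesgue. t \<in> {0..T} \<longrightarrow>
        (\<exists>v\<in>F (y t). (y has_vector_derivative v) (at t within {0..T}))"
      by (subst (asm) AE_restrict_space_iff) auto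
    then obtain N where N: "N \<in> null_sets lebesgue" "{t \<in> space lebesgue. \<not> (t \<in> {0..T} \<longrightarrow>
        (\<exists>v\<in>F (y t). (y has_vector_derivative v) (at t within {0..T})))} \<subseteq> N"
      unfolding eventually_ae_filter by blast
    have "\<exists>v\<in>F (y t). (y has_vector_derivative v) (at t)" if "t \<in> {0<..<T} - N" for t
    proof -
      have "t \<notin> {t \<in> space lebesgue. \<not> (t \<in> {0..T} \<longrightarrow>
          (\<exists>v\<in>F (y t). (y has_vector_derivative v) (at t within {0..T})))}"
        using that N(2) by blast
      then have "\<exists>v\<in>F (y t). (y has_vector_derivative v) (at t within {0..T})"
        using that by simp
      then show ?thesis using that at[of t] by simp
    qed
    then show ?N
      using N(1) by (auto simp: negligible_iff_null_sets)
  next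
    assume ?N
    then obtain N where N: "negligible N"
      "\<And>t. t \<in> {0<..<T} - N \<Longrightarrow> \<exists>v\<in>F (y t). (y has_vector_derivative v) (at t)"
      by blast
    have null: "N \<union> {0, T} \<in> null_sets lebesgue"
      using N(1) by (simp add: negligible_iff_null_sets[symmetric])
    have "AE t in lebesgue. t \<in> {0..T} \<longrightarrow>
        (\<exists>v\<in>F (y t). (y has_vector_derivative v) (at t within {0..T}))"
    proof (rule AE_I'[OF null], rule subsetI, rule ccontr)
      fix t assume t: "t \<in> {t \<in> space lebesgue. \<not> (t \<in> {0..T} \<longrightarrow>
        (\<exists>v\<in>F (y t). (y has_vector_derivative v) (at t within {0..T})))}" "t \<notin> N \<union> {0, T}"
      then have "t \<in> {0<..<T}" by auto
      with t N(2)[of t] at[of t] show False by auto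
    qed
    then show ?AE by (subst AE_restrict_space_iff) auto
  qed
  then show ?thesis unfolding trajectory_def by blast
qed

text \<open>At horizon 0 the inclusion is vacuous; over a longer time a constant curve need not
  satisfy it.\<close>

lemma trajectory_const: "trajectory F x 0 (\<lambda>_. x)"
  unfolding trajectory_iff
  by (auto intro!: abs_continuous_lipschitz[where M = 0] exI[of _ "{}"])

text \<open>Testing against a fixed \<open>w\<close> turns the differential inclusion into a lower
  bound for the derivative of a real function. The later displacement estimates for arbitrary
  trajectories, in norm or in a direction, all come from this one.\<close>

lemma trajectory_inner_growth:
  assumes y: "trajectory F x0 T y" and ab: "0 \<le> a" "a \<le> b" "b \<le> T"
    and c: "\<And>t v. \<lbrakk>a < t; t < b; v \<in> F (y t)\<rbrakk> \<Longrightarrow> c \<le> w \<bullet> v"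
  shows "c * (b - a) \<le> w \<bullet> (y b - y a)"
proof -
  obtain N where AC: "abs_continuous_on_Icc 0 T y" and N: "negligible N"
    "\<And>t. t \<in> {0<..<T} - N \<Longrightarrow> \<exists>v\<in>F (y t). (y has_vector_derivative v) (at t)"
    using y unfolding trajectory_iff by blast
  have "c * (b - a) \<le> w \<bullet> y b - w \<bullet> y a"
  proof (rule abs_continuous_growth)
    show "abs_continuous_on_Icc a b (\<lambda>t. w \<bullet> y t)"
      using abs_continuous_compose_mono[OF abs_continuous_inner[OF AC], of a b "\<lambda>t. t"] ab by simp
    show "negligible (N \<union> {a, b})" using N(1) by simp
    fix t assume t: "t \<in> {a..b} - (N \<union> {a, b})"
    then obtain v where v: "v \<in> F (y t)" "(y has_vector_derivative v) (at t)"
      using N(2)[of t] ab by fastforce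
    then have "((\<lambda>t. w \<bullet> y t) has_vector_derivative w \<bullet> v) (at t)"
      by (intro bounded_linear.has_vector_derivative[OF bounded_linear_inner_right])
    moreover have "c \<le> w \<bullet> v" using c[of t v] v t by auto
    ultimately show "\<exists>d\<ge>c. ((\<lambda>t. w \<bullet> y t) has_vector_derivative d) (at t)" by blast
  qed (fact ab)
  then show ?thesis by (simp add: inner_diff_right)
qed

lemma trajectory_norm_growth:
  assumes y: "trajectory F x0 T y" and ab: "0 \<le> a" "a \<le> b" "b \<le> T"
    and M: "\<And>t v. \<lbrakk>a < t; t < b; v \<in> F (y t)\<rbrakk> \<Longrightarrow> norm v \<le> M"
  shows "norm (y b - y a) \<le> M * (b - a)"
proof (cases "y b = y a \<or> a = b")
  case True
  show ?thesis
  proof (cases "a = b")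
    case False
    obtain N where N: "negligible N"
      "\<And>t. t \<in> {0<..<T} - N \<Longrightarrow> \<exists>v\<in>F (y t). (y has_vector_derivative v) (at t)"
      using y unfolding trajectory_iff by blast
    \<comment> \<open>With zero displacement it remains to see \<open>0 \<le> M\<close>: some time
      in the interval has a velocity, and its norm is at most \<open>M\<close>.\<close>
    have "\<not> negligible {a<..<b}"
      using False ab by (intro open_not_negligible) auto
    then obtain t where "t \<in> {a<..<b} - N"
      using N(1) negligible_subset by blast
    then obtain v where "v \<in> F (y t)" "a < t" "t < b"
      using N(2)[of t] ab by fastforce
    then have "0 \<le> M" using M[of t v] norm_ge_zero[of v] by linarith
    then show ?thesis using True False ab by simp
  qed simp
next
  case False
  \<comment> \<open>The available growth estimate is a lower bound, so the test vector points
    against the displacement.\<close>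
  define w where "w = - (y b - y a)"
  have "norm w > 0" using False by (auto simp: w_def)
  have "- (norm w * M) * (b - a) \<le> w \<bullet> (y b - y a)"
  proof (rule trajectory_inner_growth[OF y ab])
    fix t v assume "a < t" "t < b" "v \<in> F (y t)"
    then have "norm w * norm v \<le> norm w * M"
      using M by (intro mult_left_mono) auto
    then show "- (norm w * M) \<le> w \<bullet> v"
      using Cauchy_Schwarz_ineq2[of w v] by linarith
  qed
  also have "y b - y a = - w" by (simp add: w_def)
  also have "w \<bullet> (- w) = - (norm w * norm w)"
    by (simp add: power2_norm_eq_inner[symmetric] power2_eq_square)
  finally have "norm w * norm w \<le> norm w * (M * (b - a))" by (simp add: mult.assoc)
  then have "norm w \<le> M * (b - a)" using \<open>norm w > 0\<close> by simp
  then show ?thesis by (simp add: w_def norm_minus_commute)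
qed

lemma trajectory_continuous_on:
  "trajectory F x0 T y \<Longrightarrow> continuous_on {0..T} y"
  unfolding trajectory_def by (blast intro: abs_continuous_imp_continuous_on)

lemma trajectory_start: "trajectory F x0 T y \<Longrightarrow> y 0 = x0"
  by (simp add: trajectory_def)

section \<open>Shifting and concatenating trajectories\<close>

lemma has_vector_derivative_shift:
  assumes "(f has_vector_derivative v) (at (t + c))"
  shows "((\<lambda>t. f (t + c)) has_vector_derivative v) (at t)"
proof -
  have "((\<lambda>t. t + c) has_vector_derivative 1) (at t)"
    by (auto intro!: derivative_eq_intros)
  from vector_diff_chain_at[OF this, of f v] assms show ?thesis
    by (simp add: o_def)
qed

lemma trajectory_shift:
  assumes y: "trajectory F x0 T y" and s: "0 \<le> s" "s \<le> T"
  shows "trajectory F (y s) (T - s) (\<lambda>t. y (t + s))"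
  unfolding trajectory_iff
proof (intro conjI)
  obtain N where AC: "abs_continuous_on_Icc 0 T y" and N: "negligible N"
    "\<And>t. t \<in> {0<..<T} - N \<Longrightarrow> \<exists>v\<in>F (y t). (y has_vector_derivative v) (at t)"
    using y unfolding trajectory_iff by blast
  show "abs_continuous_on_Icc 0 (T - s) (\<lambda>t. y (t + s))"
    by (rule abs_continuous_compose_mono[OF AC]) (use s in auto)
  show "\<exists>N. negligible N \<and> (\<forall>t\<in>{0<..<T - s} - N. \<exists>v\<in>F (y (t + s)).
      ((\<lambda>t. y (t + s)) has_vector_derivative v) (at t))"
  proof (intro exI conjI ballI)
    show "negligible ((+) (- s) ` N)" using N(1) by (rule negligible_translation)
    fix t assume t: "t \<in> {0<..<T - s} - (+) (- s) ` N"
    then have "t + s \<in> {0<..<T} - N" using s by (auto simp: image_iff)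
    from N(2)[OF this] show "\<exists>v\<in>F (y (t + s)). ((\<lambda>t. y (t + s)) has_vector_derivative v) (at t)"
      by (blast intro: has_vector_derivative_shift)
  qed
qed simp

lemma trajectory_append:
  assumes y: "trajectory F x0 S y" and z: "trajectory F (y S) T z" and "0 \<le> S" "0 \<le> T"
  obtains w where "trajectory F x0 (S + T) w" "w (S + T) = z T"
proof
  \<comment> \<open>Writing the concatenation as a sum of two curves with clamped time reduces its
    absolute continuity to the rules for monotone time changes and sums.\<close>
  define w where "w t = y (min t S) + (z (max (t - S) 0) - y S)" for t
  have z0: "z 0 = y S" using z by (rule trajectory_start)
  have w: "w t = y t" if "t \<le> S" for t
    using that by (simp add: w_def z0 max_def)
  have w': "w t = z (t - S)" if "t \<ge> S" for t
    using that by (simp add: w_def min_def)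
  show "w (S + T) = z T" using w'[of "S + T"] \<open>0 \<le> T\<close> by simp
  obtain N where ACy: "abs_continuous_on_Icc 0 S y" and N: "negligible N"
    "\<And>t. t \<in> {0<..<S} - N \<Longrightarrow> \<exists>v\<in>F (y t). (y has_vector_derivative v) (at t)"
    using y unfolding trajectory_iff by blast
  obtain N' where ACz: "abs_continuous_on_Icc 0 T z" and N': "negligible N'"
    "\<And>t. t \<in> {0<..<T} - N' \<Longrightarrow> \<exists>v\<in>F (z t). (z has_vector_derivative v) (at t)"
    using z unfolding trajectory_iff by blast
  show "trajectory F x0 (S + T) w"
    unfolding trajectory_iff
  proof (intro conjI)
    have "abs_continuous_on_Icc 0 (S + T) (\<lambda>t. y (min t S))"
      by (rule abs_continuous_compose_mono[OF ACy]) (use \<open>0 \<le> S\<close> in auto)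
    moreover have "abs_continuous_on_Icc 0 (S + T) (\<lambda>t. z (max (t - S) 0))"
      by (rule abs_continuous_compose_mono[OF ACz]) (use \<open>0 \<le> T\<close> in auto)
    moreover have "abs_continuous_on_Icc 0 (S + T) (\<lambda>t. - y S)"
      by (rule abs_continuous_lipschitz[where M = 0]) simp
    ultimately have "abs_continuous_on_Icc 0 (S + T) (\<lambda>t. y (min t S) + (z (max (t - S) 0) + - y S))"
      by (intro abs_continuous_add)
    then show "abs_continuous_on_Icc 0 (S + T) w" by (simp add: w_def[abs_def])
    show "\<exists>N. negligible N \<and> (\<forall>t\<in>{0<..<S + T} - N. \<exists>v\<in>F (w t). (w has_vector_derivative v) (at t))"
    proof (intro exI conjI ballI)
      \<comment> \<open>The junction time \<open>S\<close> is exceptional too, since the two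
        one-sided velocities may differ there.\<close>
      show "negligible (N \<union> (+) S ` N' \<union> {S})"
        using N(1) N'(1) by (simp add: negligible_translation)
      fix t assume t: "t \<in> {0<..<S + T} - (N \<union> (+) S ` N' \<union> {S})"
      show "\<exists>v\<in>F (w t). (w has_vector_derivative v) (at t)"
      proof (cases "t < S")
        case True
        then obtain v where v: "v \<in> F (y t)" "(y has_vector_derivative v) (at t)"
          using t N(2)[of t] by auto
        have "(w has_vector_derivative v) (at t)"
          by (rule has_vector_derivative_transform_within_open[OF v(2), of "{..<S}"])
            (use True w in auto)
        then show ?thesis using v(1) w[of t] True by auto
      next
        case False
        then have "S < t" "t - S \<notin> N'" "t < S + T" using t by (auto simp: image_iff)
        then obtain v where v: "v \<in> F (z (t - S))" "(z has_vector_derivative v) (at (t - S))"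
          using N'(2)[of "t - S"] by auto
        then have "((\<lambda>t. z (t + - S)) has_vector_derivative v) (at t)"
          by (intro has_vector_derivative_shift) simp
        then have "(w has_vector_derivative v) (at t)"
          by (rule has_vector_derivative_transform_within_open[of _ _ _ "{S<..}"])
            (use \<open>S < t\<close> w' in auto)
        then show ?thesis using v(1) w'[of t] \<open>S < t\<close> by auto
      qed
    qed
    show "w 0 = x0" using w[of 0] \<open>0 \<le> S\<close> trajectory_start[OF y] by simp
  qed
qed

text \<open>Allowing \<open>T = 0\<close> absorbs the case \<open>x \<in> K\<close> of the definition.\<close>

lemma min_time_less_iff:
  "min_time F K x < ereal b \<longleftrightarrow> (\<exists>T\<ge>0. T < b \<and> (\<exists>y. trajectory F x T y \<and> y T \<in> K))"
proof (cases "x \<in> K")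
  case True
  have "\<exists>T\<ge>0. T < b \<and> (\<exists>y. trajectory F x T y \<and> y T \<in> K)" if "0 < b"
    using True trajectory_const[of F x] that by (intro exI[of _ 0]) auto
  then show ?thesis using True by (auto simp: min_time_def)
next
  case False
  have "0 < T" if "trajectory F x T y" "y T \<in> K" "T \<ge> 0" for T y
    using that False trajectory_start[OF that(1)] by (cases "T = 0") auto
  moreover have "min_time F K x < ereal b \<longleftrightarrow> (\<exists>T>0. T < b \<and> (\<exists>y. trajectory F x T y \<and> y T \<in> K))"
    using False by (auto simp: min_time_def INF_less_iff)
  ultimately show ?thesis by (meson less_imp_le)
qed

text \<open>The infimum is not known to be attained, so a bound by \<open>b\<close> is expressed
  through arrival times below every larger \<open>b'\<close>.\<close>

lemma min_time_le_iff:
  "min_time F K x \<le> ereal b \<longleftrightarrow>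
    (\<forall>b'>b. \<exists>T\<ge>0. T < b' \<and> (\<exists>y. trajectory F x T y \<and> y T \<in> K))"
proof -
  have "min_time F K x \<le> ereal b \<longleftrightarrow> (\<forall>b'>b. min_time F K x < ereal b')"
  proof (intro iffI allI impI)
    assume *: "\<forall>b'>b. min_time F K x < ereal b'"
    show "min_time F K x \<le> ereal b"
    proof (rule ccontr)
      assume "\<not> min_time F K x \<le> ereal b"
      then obtain b' where "ereal b < ereal b'" "ereal b' < min_time F K x"
        using ereal_dense2[of "ereal b"] by (auto simp: not_le)
      with * show False by (auto dest: spec[of _ b'])
    qed
  qed (auto intro: le_less_trans)
  then show ?thesis by (simp add: min_time_less_iff)
qed

text \<open>Prefixing \<open>y\<close> to a nearly optimal trajectory from \<open>y s\<close> gives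
  a competitor for \<open>z\<close>. This controls the minimum time when moving backwards.\<close>

lemma min_time_append:
  assumes y: "trajectory F z s y" and "0 \<le> s" "min_time F K (y s) \<le> ereal b"
  shows "min_time F K z \<le> ereal (s + b)"
  unfolding min_time_le_iff
proof (intro allI impI)
  fix b' assume "s + b < b'"
  then have "b' - s > b" by simp
  then obtain T y' where "0 \<le> T" "T < b' - s" "trajectory F (y s) T y'" "y' T \<in> K"
    using assms(3) unfolding min_time_le_iff by blast
  then show "\<exists>T\<ge>0. T < b' \<and> (\<exists>y. trajectory F z T y \<and> y T \<in> K)"
    using trajectory_append[OF y _ \<open>0 \<le> s\<close>, of T y'] \<open>0 \<le> s\<close>
    by (metis add.commute add_nonneg_nonneg less_diff_eq)
qed

text \<open>The remaining piece of \<open>y\<close> is a competitor from \<open>y s\<close>. As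
  \<open>y\<close> need not be optimal, its own arrival time \<open>T\<close> appears in the
  bound.\<close>

lemma min_time_along:
  assumes y: "trajectory F x T y" "y T \<in> K" and s: "0 \<le> s" "s \<le> T"
  shows "min_time F K (y s) \<le> ereal (T - s)"
  unfolding min_time_le_iff
proof (intro allI impI)
  fix b' assume "T - s < b'"
  then show "\<exists>T\<ge>0. T < b' \<and> (\<exists>z. trajectory F (y s) T z \<and> z T \<in> K)"
    using trajectory_shift[OF y(1) s] y(2) s
    by (intro exI[of _ "T - s"] conjI exI[of _ "\<lambda>t. y (t + s)"]) auto
qed

section \<open>Local estimates for trajectories\<close>

lemma assumption_F_lipschitz:
  assumes "assumption_F F" "compact Q"
  obtains L where "L > 0"
    "\<And>y z v. \<lbrakk>y \<in> Q; z \<in> Q; v \<in> F y\<rbrakk> \<Longrightarrow> \<exists>w\<in>F z. norm (v - w) \<le> L * norm (y - z)"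
proof -
  obtain L where "L > 0" and L: "\<forall>x\<in>Q. \<forall>y\<in>Q.
        F x \<subseteq> {w + (L * norm (y - x)) *\<^sub>R u | w u. w \<in> F y \<and> u \<in> cball 0 1}"
    using assms unfolding assumption_F_def by meson
  show thesis
  proof (rule that[OF \<open>L > 0\<close>])
    fix y z v assume "y \<in> Q" "z \<in> Q" "v \<in> F y"
    then obtain w u where w: "v = w + (L * norm (z - y)) *\<^sub>R u" "w \<in> F z" "norm u \<le> 1"
      using L by fastforce
    have "norm (v - w) = L * norm (z - y) * norm u"
      using w(1) \<open>L > 0\<close> by simp
    also have "\<dots> \<le> L * norm (z - y) * 1"
      using w(3) \<open>L > 0\<close> by (intro mult_left_mono) auto
    finally have "norm (v - w) \<le> L * norm (z - y)" by simp
    then show "\<exists>w\<in>F z. norm (v - w) \<le> L * norm (y - z)"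
      using w(2) by (auto simp: norm_minus_commute)
  qed
qed

lemma assumption_F_bounded:
  assumes F: "assumption_F F" and "bounded Q"
  obtains M where "M > 0" "\<And>y v. \<lbrakk>y \<in> Q; v \<in> F y\<rbrakk> \<Longrightarrow> norm v \<le> M"
proof -
  have "\<exists>\<gamma>>0. \<forall>x. \<forall>v\<in>F x. norm v \<le> \<gamma> * (1 + norm x)"
    using F unfolding assumption_F_def by (elim conjE)
  then obtain \<gamma> where "\<gamma> > 0" and \<gamma>: "\<And>x v. v \<in> F x \<Longrightarrow> norm v \<le> \<gamma> * (1 + norm x)"
    by auto
  obtain B where "B > 0" and B: "\<And>x. x \<in> Q \<Longrightarrow> norm x \<le> B"
    using \<open>bounded Q\<close> unfolding bounded_pos by blast
  show thesis
  proof (rule that[of "\<gamma> * (1 + B)"])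
    show "\<gamma> * (1 + B) > 0" using \<open>\<gamma> > 0\<close> \<open>B > 0\<close> by simp
    fix y v assume "y \<in> Q" "v \<in> F y"
    then have "norm v \<le> \<gamma> * (1 + norm y)" by (intro \<gamma>)
    also have "\<dots> \<le> \<gamma> * (1 + B)"
      using B[OF \<open>y \<in> Q\<close>] \<open>\<gamma> > 0\<close> by simp
    finally show "norm v \<le> \<gamma> * (1 + B)" .
  qed
qed

text \<open>The speed bound is known only in the unit ball about \<open>y0\<close>, so a first exit
  argument is used: at the earliest time \<open>r\<close> with distance at least 1, the bound up to
  \<open>r\<close> would give distance at most \<open>M * r < 1\<close>.\<close>

lemma trajectory_speed_bound:
  assumes y: "trajectory F y0 T y" and t: "0 \<le> t" "t \<le> T" "M * t < 1"
    and M: "\<And>z v. \<lbrakk>z \<in> cball y0 1; v \<in> F z\<rbrakk> \<Longrightarrow> norm v \<le> M" and "M > 0"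
  shows "norm (y t - y0) \<le> M * t"
proof -
  have cont: "continuous_on {0..t} (\<lambda>s. norm (y s - y0))"
    using continuous_on_subset[OF trajectory_continuous_on[OF y], of "{0..t}"] t
    by (intro continuous_intros) auto
  have y0: "y 0 = y0" using y by (rule trajectory_start)
  have *: "norm (y s - y0) \<le> M * s"
    if "0 \<le> s" "s \<le> t" "\<And>r. \<lbrakk>0 < r; r < s\<rbrakk> \<Longrightarrow> norm (y r - y0) \<le> 1" for s
  proof -
    have "norm (y s - y 0) \<le> M * (s - 0)"
    proof (rule trajectory_norm_growth[OF y])
      fix r v assume "0 < r" "r < s" "v \<in> F (y r)"
      then show "norm v \<le> M"
        using that(3)[of r] by (intro M[of "y r"]) (auto simp: dist_norm norm_minus_commute)
    qed (use that t in auto)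
    then show ?thesis using y0 by simp
  qed
  have "norm (y s - y0) < 1" if s: "0 \<le> s" "s \<le> t" for s
  proof (rule ccontr)
    assume "\<not> norm (y s - y0) < 1"
    define E where "E = {0..t} \<inter> (\<lambda>r. norm (y r - y0)) -` {1..}"
    have "closed E"
      unfolding E_def by (intro continuous_closed_preimage cont closed_atLeast closed_atLeastAtMost)
    moreover have "bounded E"
      by (rule bounded_subset[of "{0..t}"]) (auto simp: E_def)
    ultimately have "compact E" by (simp add: compact_eq_bounded_closed)
    have "E \<noteq> {}" using \<open>\<not> norm (y s - y0) < 1\<close> s by (auto simp: E_def)
    then obtain r where r: "r \<in> E" "\<And>q. q \<in> E \<Longrightarrow> r \<le> q"
      using compact_attains_inf[OF \<open>compact E\<close>] by blast
    have "norm (y r - y0) \<le> M * r"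
    proof (rule *)
      fix q assume q: "0 < q" "q < r"
      then have "q \<notin> E" using r(2)[of q] by auto
      then show "norm (y q - y0) \<le> 1" using q r(1) by (auto simp: E_def)
    qed (use r(1) in \<open>auto simp: E_def\<close>)
    also have "\<dots> \<le> M * t" using r(1) \<open>M > 0\<close> by (simp add: E_def)
    finally show False using r(1) t by (simp add: E_def)
  qed
  then show ?thesis using *[of t] t by (auto intro: less_imp_le)
qed

text \<open>At time \<open>t\<close> the curve is within \<open>norm (y0 - x) + M * t\<close> of
  \<open>x\<close>, so by the Lipschitz condition each of its velocities is that close, up to a
  factor, to an element of \<open>F x\<close>, and a lower bound \<open>c\<close> on
  \<open>F x\<close> deteriorates only by this amount. The constants depend on \<open>x\<close>
  alone, uniformly in the start point, the direction and \<open>c\<close>.\<close>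

lemma trajectory_local_estimate:
  assumes F: "assumption_F (F :: 'a::euclidean_space \<Rightarrow> 'a set)"
  obtains \<delta> M where "\<delta> > 0" "M > 0"
    "\<And>y0 T y t. \<lbrakk>norm (y0 - x) \<le> \<delta>; trajectory F y0 T y; 0 \<le> t; t \<le> T; t \<le> \<delta>\<rbrakk>
      \<Longrightarrow> norm (y t - y0) \<le> M * t"
    "\<And>y0 T y t \<zeta> c. \<lbrakk>norm (y0 - x) \<le> \<delta>; trajectory F y0 T y; 0 \<le> t; t \<le> T; t \<le> \<delta>;
        \<And>v. v \<in> F x \<Longrightarrow> c \<le> \<zeta> \<bullet> v\<rbrakk>
      \<Longrightarrow> (c - norm \<zeta> * M * (norm (y0 - x) + t)) * t \<le> \<zeta> \<bullet> (y t - y0)"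
proof -
  obtain M where "M > 0" and M: "\<And>y v. \<lbrakk>y \<in> cball x 2; v \<in> F y\<rbrakk> \<Longrightarrow> norm v \<le> M"
    using assumption_F_bounded[OF F bounded_cball] by metis
  obtain L where "L > 0" and L:
    "\<And>y z v. \<lbrakk>y \<in> cball x 2; z \<in> cball x 2; v \<in> F y\<rbrakk> \<Longrightarrow> \<exists>w\<in>F z. norm (v - w) \<le> L * norm (y - z)"
    using assumption_F_lipschitz[OF F compact_cball] by metis
  \<comment> \<open>\<open>1\<close> places the unit ball about \<open>y0\<close> inside
    \<open>cball x 2\<close>, where \<open>M\<close> and \<open>L\<close> are valid;
    \<open>1 / (2 * M)\<close> keeps the curve in that unit ball up to time
    \<open>\<delta>\<close>.\<close>
  define \<delta> where "\<delta> = min 1 (1 / (2 * M))"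
  have "\<delta> > 0" "\<delta> \<le> 1" and \<delta>M: "M * \<delta> < 1"
    using \<open>M > 0\<close> by (auto simp: \<delta>_def min_def field_simps)
  have near: "norm (y t - y0) \<le> M * t"
    if "norm (y0 - x) \<le> \<delta>" "trajectory F y0 T y" "0 \<le> t" "t \<le> T" "t \<le> \<delta>" for y0 T y t
  proof (rule trajectory_speed_bound[OF that(2-4) _ _ \<open>M > 0\<close>])
    have "M * t \<le> M * \<delta>" using that \<open>M > 0\<close> by simp
    then show "M * t < 1" using \<delta>M by linarith
    fix z v assume "z \<in> cball y0 1" "v \<in> F z"
    moreover have "dist x z \<le> dist x y0 + dist y0 z" by (rule dist_triangle)
    ultimately show "norm v \<le> M"
      using that(1) \<open>\<delta> \<le> 1\<close> by (intro M[of z]) (auto simp: dist_norm norm_minus_commute)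
  qed
  \<comment> \<open>One constant for three purposes: \<open>M\<close> bounds the displacement, while
    \<open>L\<close> and \<open>L * M\<close> are the coefficients of \<open>norm (y0 - x)\<close>
    and \<open>t\<close> in the deviation of the velocities.\<close>
  define M' where "M' = max M (L * max 1 M)"
  have "M' \<ge> M" "M' \<ge> L" "M' \<ge> L * M" and "M' > 0"
    using \<open>M > 0\<close> \<open>L > 0\<close> by (auto simp: M'_def max_def mult_le_cancel_left1)
  show thesis
  proof (rule that[OF \<open>\<delta> > 0\<close> \<open>M' > 0\<close>])
    fix y0 T y t
    assume t: "norm (y0 - x) \<le> \<delta>" "trajectory F y0 T y" "0 \<le> t" "t \<le> T" "t \<le> \<delta>"
    have "M * t \<le> M' * t" using \<open>M' \<ge> M\<close> t(3) by (rule mult_right_mono)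
    then show "norm (y t - y0) \<le> M' * t" using near[OF t] by linarith
    fix \<zeta> c assume c: "\<And>v. v \<in> F x \<Longrightarrow> c \<le> \<zeta> \<bullet> v"
    have "c - norm \<zeta> * M' * (norm (y0 - x) + t) \<le> \<zeta> \<bullet> v" if s: "0 < s" "s < t" "v \<in> F (y s)" for s v
    proof -
      have "norm (y s - y0) \<le> M * s" using near[OF t(1,2), of s] s t by auto
      also have "M * s \<le> M * t" using s \<open>M > 0\<close> by simp
      finally have ys: "norm (y s - x) \<le> norm (y0 - x) + M * t"
        using norm_triangle_ineq[of "y s - y0" "y0 - x"] by simp
      moreover have "M * t \<le> M * \<delta>" using t \<open>M > 0\<close> by simp
      ultimately have "norm (y s - x) \<le> 2" using t(1) \<delta>M \<open>\<delta> \<le> 1\<close> by linarith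
      then obtain w where w: "w \<in> F x" "norm (v - w) \<le> L * norm (y s - x)"
        using L[of "y s" x v] s by (auto simp: dist_norm norm_minus_commute)
      have "L * norm (y s - x) \<le> L * norm (y0 - x) + L * M * t"
        using mult_left_mono[OF ys, of L] \<open>L > 0\<close> by (simp add: algebra_simps)
      also have "\<dots> \<le> M' * norm (y0 - x) + M' * t"
        using \<open>M' \<ge> L\<close> \<open>M' \<ge> L * M\<close> t(3) by (intro add_mono mult_right_mono) auto
      finally have "norm (v - w) \<le> M' * (norm (y0 - x) + t)"
        using w(2) by (simp add: algebra_simps)
      then have "norm \<zeta> * norm (v - w) \<le> norm \<zeta> * (M' * (norm (y0 - x) + t))"
        by (intro mult_left_mono) auto
      moreover have "\<bar>\<zeta> \<bullet> (v - w)\<bar> \<le> norm \<zeta> * norm (v - w)" by (rule Cauchy_Schwarz_ineq2)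
      ultimately show ?thesis
        using c[OF w(1)] by (simp add: inner_diff_right algebra_simps)
    qed
    then have "(c - norm \<zeta> * M' * (norm (y0 - x) + t)) * (t - 0) \<le> \<zeta> \<bullet> (y t - y 0)"
      by (intro trajectory_inner_growth[OF t(2)]) (use t in auto)
    then show "(c - norm \<zeta> * M' * (norm (y0 - x) + t)) * t \<le> \<zeta> \<bullet> (y t - y0)"
      using trajectory_start[OF t(2)] by simp
  qed
qed

lemma min_time_pos:
  assumes F: "assumption_F (F :: 'a::euclidean_space \<Rightarrow> 'a set)" and "closed K" "x \<notin> K"
  shows "0 < min_time F K x"
proof -
  obtain \<delta> M where "\<delta> > 0" "M > 0" and near:
    "\<And>y0 T y t. \<lbrakk>norm (y0 - x) \<le> \<delta>; trajectory F y0 T y; 0 \<le> t; t \<le> T; t \<le> \<delta>\<rbrakk>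
      \<Longrightarrow> norm (y t - y0) \<le> M * t"
    using trajectory_local_estimate[OF F, of x] by metis
  obtain e where "e > 0" and e: "\<And>z. z \<in> K \<Longrightarrow> e \<le> dist x z"
    using separate_point_closed[OF \<open>closed K\<close> \<open>x \<notin> K\<close>] by auto
  \<comment> \<open>Up to time \<open>e / (2 * M)\<close> at most half the distance \<open>e\<close>
    to \<open>K\<close> can be covered.\<close>
  define \<tau> where "\<tau> = min \<delta> (e / (2 * M))"
  have "\<tau> > 0" using \<open>\<delta> > 0\<close> \<open>M > 0\<close> \<open>e > 0\<close> by (simp add: \<tau>_def)
  have "\<not> min_time F K x < ereal \<tau>"
  proof
    assume "min_time F K x < ereal \<tau>"
    then obtain T y where y: "0 \<le> T" "T < \<tau>" "trajectory F x T y" "y T \<in> K"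
      unfolding min_time_less_iff by blast
    have "norm (y T - x) \<le> M * T"
      using near[OF _ y(3), of T] y \<open>\<delta> > 0\<close> by (simp add: \<tau>_def)
    also have "\<dots> \<le> M * (e / (2 * M))"
      using y(2) \<open>M > 0\<close> by (intro mult_left_mono) (auto simp: \<tau>_def)
    also have "\<dots> = e / 2" using \<open>M > 0\<close> by simp
    finally show False using e[OF y(4)] \<open>e > 0\<close> by (simp add: dist_norm norm_minus_commute)
  qed
  then show ?thesis using \<open>\<tau> > 0\<close> by (meson ereal_less(2) less_le_trans not_less)
qed

section \<open>Trajectories arriving with a prescribed velocity\<close>

text \<open>Projections onto convex sets depend on the set with a square-root modulus. The square of
  \<open>norm (p - q)\<close> splits into four inner products: two are nonpositive because
  \<open>p\<close> and \<open>q\<close> are projections, the other two carry the errors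
  \<open>p - p'\<close> and \<open>q - q'\<close> of size \<open>\<eta>\<close>.\<close>

lemma closest_point_set_variation:
  fixes A B :: "'a::euclidean_space set"
  assumes A: "convex A" "closed A" "A \<noteq> {}" and B: "convex B" "closed B" "B \<noteq> {}"
    and AB: "\<And>a. a \<in> A \<Longrightarrow> \<exists>b\<in>B. norm (a - b) \<le> \<eta>"
    and BA: "\<And>b. b \<in> B \<Longrightarrow> \<exists>a\<in>A. norm (b - a) \<le> \<eta>"
  shows "(norm (closest_point A w - closest_point B w))\<^sup>2
    \<le> \<eta> * (norm (w - closest_point A w) + norm (w - closest_point B w))"
proof -
  define p q where "p = closest_point A w" and "q = closest_point B w"
  have "p \<in> A" "q \<in> B"
    using A B by (auto simp: p_def q_def closest_point_in_set)
  then obtain p' q' where p': "p' \<in> B" "norm (p - p') \<le> \<eta>" and q': "q' \<in> A" "norm (q - q') \<le> \<eta>"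
    using AB BA by metis
  have "(w - p) \<bullet> (q' - p) \<le> 0"
    using closest_point_dot[OF A(1,2) q'(1)] by (simp add: p_def)
  moreover have "(w - q) \<bullet> (p' - q) \<le> 0"
    using closest_point_dot[OF B(1,2) p'(1)] by (simp add: q_def)
  moreover have "(w - p) \<bullet> (q - q') \<le> norm (w - p) * \<eta>"
    using norm_cauchy_schwarz[of "w - p" "q - q'"] q'(2) mult_left_mono[of _ _ "norm (w - p)"]
    by (meson norm_ge_zero order_trans)
  moreover have "(w - q) \<bullet> (p - p') \<le> norm (w - q) * \<eta>"
    using norm_cauchy_schwarz[of "w - q" "p - p'"] p'(2) mult_left_mono[of _ _ "norm (w - q)"]
    by (meson norm_ge_zero order_trans)
  moreover have "(norm (p - q))\<^sup>2
      = (w - p) \<bullet> (q' - p) + (w - p) \<bullet> (q - q') + (w - q) \<bullet> (p' - q) + (w - q) \<bullet> (p - p')"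
    by (simp add: power2_norm_eq_inner inner_diff_left inner_diff_right inner_commute)
  ultimately show ?thesis
    unfolding p_def[symmetric] q_def[symmetric] by (simp add: algebra_simps)
qed

text \<open>This keeps the iterates of the backward construction continuous, so that their integrals
  are differentiable at every interior time.\<close>

lemma continuous_on_closest_point_selection:
  fixes F :: "'a::euclidean_space \<Rightarrow> 'a set" and S :: "real set"
  assumes F: "assumption_F F" and "compact Q"
    and y: "continuous_on S y" "\<And>t. t \<in> S \<Longrightarrow> y t \<in> Q" and w: "continuous_on S w"
  shows "continuous_on S (\<lambda>t. closest_point (F (y t)) (w t))"
proof -
  have Fx: "convex (F z)" "closed (F z)" "F z \<noteq> {}" for z
    using F by (auto simp: assumption_F_def compact_imp_closed)
  obtain L where "L > 0" and L:
    "\<And>y z v. \<lbrakk>y \<in> Q; z \<in> Q; v \<in> F y\<rbrakk> \<Longrightarrow> \<exists>w\<in>F z. norm (v - w) \<le> L * norm (y - z)"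
    using assumption_F_lipschitz[OF F \<open>compact Q\<close>] by metis
  obtain M where "M > 0" and M: "\<And>y v. \<lbrakk>y \<in> Q; v \<in> F y\<rbrakk> \<Longrightarrow> norm v \<le> M"
    using assumption_F_bounded[OF F compact_imp_bounded[OF \<open>compact Q\<close>]] by metis
  have "((\<lambda>t. closest_point (F (y t)) (w t)) \<longlongrightarrow> closest_point (F (y t0)) (w t0)) (at t0 within S)"
    if "t0 \<in> S" for t0
  proof (rule LIM_zero_cancel, rule Lim_null_comparison)
    \<comment> \<open>The first term accounts for moving the projected point, the second for moving
      the set; \<open>2 * (norm (w t0) + M)\<close> bounds the sum of the two distances to the
      projections.\<close>
    define h where "h t = norm (w t - w t0) + sqrt (L * norm (y t - y t0) * (2 * (norm (w t0) + M)))" for t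
    have "norm (closest_point (F (y t)) (w t) - closest_point (F (y t0)) (w t0)) \<le> h t" if "t \<in> S" for t
    proof -
      let ?p = "closest_point (F (y t)) (w t0)" and ?q = "closest_point (F (y t0)) (w t0)"
      have "norm (closest_point (F (y t)) (w t) - ?p) \<le> norm (w t - w t0)"
        using closest_point_lipschitz[OF Fx, of "y t" "w t" "w t0"] by (simp add: dist_norm)
      moreover have "norm (?p - ?q) \<le> sqrt (L * norm (y t - y t0) * (2 * (norm (w t0) + M)))"
      proof (rule real_le_rsqrt)
        have "(norm (?p - ?q))\<^sup>2 \<le> L * norm (y t - y t0) * (norm (w t0 - ?p) + norm (w t0 - ?q))"
        proof (rule closest_point_set_variation[OF Fx Fx])
          show "\<exists>b\<in>F (y t0). norm (a - b) \<le> L * norm (y t - y t0)" if "a \<in> F (y t)" for a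
            using L[of "y t" "y t0" a] y(2) \<open>t \<in> S\<close> \<open>t0 \<in> S\<close> that by auto
          show "\<exists>b\<in>F (y t). norm (a - b) \<le> L * norm (y t - y t0)" if "a \<in> F (y t0)" for a
            using L[of "y t0" "y t" a] y(2) \<open>t \<in> S\<close> \<open>t0 \<in> S\<close> that by (auto simp: norm_minus_commute)
        qed
        also have "\<dots> \<le> L * norm (y t - y t0) * (2 * (norm (w t0) + M))"
        proof (rule mult_left_mono)
          have "norm ?p \<le> M" "norm ?q \<le> M"
            using M[OF y(2)[OF \<open>t \<in> S\<close>] closest_point_in_set[OF Fx(2,3)]]
              M[OF y(2)[OF \<open>t0 \<in> S\<close>] closest_point_in_set[OF Fx(2,3)]] by simp_all
          then have "norm (w t0 - ?p) \<le> norm (w t0) + M" "norm (w t0 - ?q) \<le> norm (w t0) + M"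
            by (auto intro: order_trans[OF norm_triangle_ineq4])
          then show "norm (w t0 - ?p) + norm (w t0 - ?q) \<le> 2 * (norm (w t0) + M)"
            unfolding mult_2 by (rule add_mono)
        qed (use \<open>L > 0\<close> in simp)
        finally show "(norm (?p - ?q))\<^sup>2 \<le> L * norm (y t - y t0) * (2 * (norm (w t0) + M))" .
      qed
      ultimately show ?thesis
        using norm_triangle_ineq[of "closest_point (F (y t)) (w t) - ?p" "?p - ?q"] by (simp add: h_def)
    qed
    then show "\<forall>\<^sub>F t in at t0 within S.
        norm (closest_point (F (y t)) (w t) - closest_point (F (y t0)) (w t0)) \<le> h t"
      by (auto simp: eventually_at_filter)
    have "(w \<longlongrightarrow> w t0) (at t0 within S)" "(y \<longlongrightarrow> y t0) (at t0 within S)"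
      using w y(1) \<open>t0 \<in> S\<close> by (auto simp: continuous_on_def)
    then have "(h \<longlongrightarrow> norm (w t0 - w t0) + sqrt (L * norm (y t0 - y t0) * (2 * (norm (w t0) + M))))
        (at t0 within S)"
      unfolding h_def by (intro tendsto_intros)
    then show "(h \<longlongrightarrow> 0) (at t0 within S)" by simp
  qed
  then show ?thesis by (simp add: continuous_on_def)
qed

text \<open>
  Filippov's iteration, backwards in time: \<open>w\<^sub>k\<^sub>+\<^sub>1(t)\<close> is the projection of \<open>w\<^sub>k(t)\<close> onto
  \<open>F (y - \<integral>\<^sub>0\<^sup>t w\<^sub>k)\<close>. Since \<open>w\<^sub>k(t)\<close> already lies in the value of \<open>F\<close> at the preceding path,
  the Lipschitz condition makes consecutive velocities contract uniformly, and all of them stay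
  continuous.
\<close>

locale filippov_iteration =
  fixes F :: "'a::euclidean_space \<Rightarrow> 'a set" and x v y :: 'a and L s :: real
  assumes F: "assumption_F F" and v: "v \<in> F x" and L_pos: "L > 0" and s_nonneg: "s \<ge> 0"
    and L: "\<And>y z v. \<lbrakk>y \<in> cball x 1; z \<in> cball x 1; v \<in> F y\<rbrakk>
      \<Longrightarrow> \<exists>w\<in>F z. norm (v - w) \<le> L * norm (y - z)"
    and Ls: "L * s \<le> 1 / 2"
    and small: "norm (y - x) + s * (norm v + 2 * (L * (norm (y - x) + s * norm v))) \<le> 1"
begin

text \<open>Size of the first correction: \<open>v\<close> lies in \<open>F x\<close>, and the
  straight path \<open>y - t *\<^sub>R v\<close> stays within
  \<open>norm (y - x) + s * norm v\<close> of \<open>x\<close>.\<close>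

definition A where "A = L * (norm (y - x) + s * norm v)"

definition path where "path w t = y - integral {0..t} w"

primrec velocity :: "nat \<Rightarrow> real \<Rightarrow> 'a" where
  "velocity 0 = (\<lambda>_. v)"
| "velocity (Suc k) = (\<lambda>t. closest_point (F (path (velocity k) t)) (velocity k t))"

lemma A_nonneg: "A \<ge> 0"
  using L_pos s_nonneg by (simp add: A_def)

lemma F_closed: "closed (F z)" "F z \<noteq> {}"
  using F by (auto simp: assumption_F_def compact_imp_closed)

lemma path_diff_bound:
  assumes "continuous_on {0..s} w" "continuous_on {0..s} w'"
    and "\<And>t. t \<in> {0..s} \<Longrightarrow> norm (w t - w' t) \<le> B" and t: "t \<in> {0..s}"
  shows "norm (path w t - path w' t) \<le> B * t"
proof -
  have cont: "continuous_on {0..t} w" "continuous_on {0..t} w'"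
    using assms(1,2) t by (auto elim: continuous_on_subset)
  have "norm (integral {0..t} (\<lambda>r. w r - w' r)) \<le> B * (t - 0)"
    by (rule integral_bound) (use cont assms t in \<open>auto intro: continuous_on_diff\<close>)
  then show ?thesis
    using cont by (simp add: path_def integral_diff integrable_continuous_real norm_minus_commute)
qed

text \<open>\<open>2 * A\<close> is the sum of all corrections \<open>A * (1/2)^k\<close>. The
  assumption \<open>small\<close> is what keeps a path with such velocities in
  \<open>cball x 1\<close>, where \<open>L\<close> is a Lipschitz constant.\<close>

lemma path_near:
  assumes w: "continuous_on {0..s} w" "\<And>t. t \<in> {0..s} \<Longrightarrow> norm (w t - v) \<le> 2 * A"
    and t: "t \<in> {0..s}"
  shows "norm (path w t - (y - t *\<^sub>R v)) \<le> 2 * A * t" "path w t \<in> cball x 1"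
proof -
  show *: "norm (path w t - (y - t *\<^sub>R v)) \<le> 2 * A * t"
    using path_diff_bound[OF w(1) _ w(2) t] t by (simp add: path_def)
  have "norm (path w t - x) \<le> norm (path w t - (y - t *\<^sub>R v)) + norm (y - x) + norm (t *\<^sub>R v)"
    using norm_triangle_ineq[of "path w t - (y - t *\<^sub>R v)" "y - x - t *\<^sub>R v"]
      norm_triangle_ineq4[of "y - x" "t *\<^sub>R v"] by (simp add: algebra_simps)
  also have "\<dots> \<le> norm (y - x) + t * (norm v + 2 * A)"
    using * t by (simp add: algebra_simps)
  also have "\<dots> \<le> norm (y - x) + s * (norm v + 2 * A)"
    using t A_nonneg by (intro add_left_mono mult_right_mono) auto
  finally show "path w t \<in> cball x 1"
    using small[folded A_def] by (simp add: dist_norm norm_minus_commute)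
qed

lemma continuous_on_path:
  assumes "continuous_on {0..s} w"
  shows "continuous_on {0..s} (path w)"
proof -
  have "continuous_on {0..s} (\<lambda>t. y - integral {0..t} w)"
    by (intro continuous_intros indefinite_integral_continuous_1 integrable_continuous_real assms)
  then show ?thesis by (simp add: path_def[abs_def])
qed

lemma velocity_in_F: "velocity (Suc k) t \<in> F (path (velocity k) t)"
  using closest_point_in_set[OF F_closed] by simp

lemma velocity_step_le:
  assumes "u \<in> F (path (velocity k) t)"
  shows "norm (velocity (Suc k) t - velocity k t) \<le> norm (velocity k t - u)"
  using closest_point_le[OF F_closed(1) assms, of "velocity k t"]
  by (simp add: dist_norm norm_minus_commute)

text \<open>The claims feed each other: the drift bound keeps the path in the ball, there the
  Lipschitz condition bounds the next correction, and the corrections add up to the drift. The drift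
  is kept as an exact geometric partial sum because \<open>2 * A\<close> alone would not be
  inductive. The ratio \<open>1/2\<close> comes from \<open>L * s\<close>.\<close>

lemma velocity_bounds_induct:
  "continuous_on {0..s} (velocity k) \<and>
   (\<forall>t\<in>{0..s}. norm (velocity k t - v) \<le> 2 * A * (1 - (1/2)^k) \<and>
     norm (velocity (Suc k) t - velocity k t) \<le> A * (1/2)^k)"
proof (induction k)
  case 0
  have "norm (velocity (Suc 0) t - velocity 0 t) \<le> A" if t: "t \<in> {0..s}" for t
  proof -
    have "path (velocity 0) t \<in> cball x 1"
      using path_near(2)[of "velocity 0" t] t A_nonneg by simp
    then obtain u where u: "u \<in> F (path (velocity 0) t)" "norm (v - u) \<le> L * norm (x - path (velocity 0) t)"
      using L[of x "path (velocity 0) t" v] v by auto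
    have eq: "x - path (velocity 0) t = (x - y) + t *\<^sub>R v"
      using t by (simp add: path_def)
    have "norm (x - path (velocity 0) t) \<le> norm (y - x) + t * norm v"
      unfolding eq using norm_triangle_ineq[of "x - y" "t *\<^sub>R v"] t by (simp add: norm_minus_commute)
    also have "\<dots> \<le> norm (y - x) + s * norm v"
      using t by (simp add: mult_right_mono)
    finally have "L * norm (x - path (velocity 0) t) \<le> A"
      using L_pos by (simp add: A_def)
    then show ?thesis
      using velocity_step_le[OF u(1)] u(2) by simp
  qed
  then show ?case by simp
next
  case (Suc k)
  then have IH: "continuous_on {0..s} (velocity k)"
    "\<And>t. t \<in> {0..s} \<Longrightarrow> norm (velocity k t - v) \<le> 2 * A * (1 - (1/2)^k)"
    "\<And>t. t \<in> {0..s} \<Longrightarrow> norm (velocity (Suc k) t - velocity k t) \<le> A * (1/2)^k"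
    by (simp_all del: velocity.simps)
  have le2A: "2 * A * (1 - (1/2)^j) \<le> 2 * A" for j :: nat
    using A_nonneg by (intro mult_left_le) auto
  have Q: "path (velocity k) t \<in> cball x 1" if "t \<in> {0..s}" for t
    using path_near(2)[OF IH(1) order_trans[OF IH(2) le2A] that] .
  have cont: "continuous_on {0..s} (velocity (Suc k))"
    using continuous_on_closest_point_selection[OF F compact_cball continuous_on_path[OF IH(1)] Q IH(1)]
    by simp
  have bound: "norm (velocity (Suc k) t - v) \<le> 2 * A * (1 - (1/2)^Suc k)" if "t \<in> {0..s}" for t
  proof -
    have "norm (velocity (Suc k) t - v) \<le> norm (velocity (Suc k) t - velocity k t) + norm (velocity k t - v)"
      using norm_triangle_ineq[of "velocity (Suc k) t - velocity k t" "velocity k t - v"] by simp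
    also have "\<dots> \<le> A * (1/2)^k + 2 * A * (1 - (1/2)^k)"
      using IH(2,3)[OF that] by (intro add_mono)
    also have "\<dots> = 2 * A * (1 - (1/2)^Suc k)"
      by (simp add: algebra_simps)
    finally show ?thesis .
  qed
  have "norm (velocity (Suc (Suc k)) t - velocity (Suc k) t) \<le> A * (1/2)^Suc k" if t: "t \<in> {0..s}" for t
  proof -
    let ?Y = "path (velocity k) t" and ?Y' = "path (velocity (Suc k)) t"
    have "?Y' \<in> cball x 1"
      using path_near(2)[OF cont order_trans[OF bound le2A] t] .
    then obtain u where u: "u \<in> F ?Y'" "norm (velocity (Suc k) t - u) \<le> L * norm (?Y - ?Y')"
      using L[OF Q[OF t] _ velocity_in_F] by blast
    have "norm (?Y' - ?Y) \<le> A * (1/2)^k * t"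
      by (rule path_diff_bound[OF cont IH(1) IH(3) t])
    also have "\<dots> \<le> A * (1/2)^k * s"
      using t A_nonneg by (intro mult_left_mono) auto
    finally have "L * norm (?Y' - ?Y) \<le> L * (A * (1/2)^k * s)"
      using L_pos by (intro mult_left_mono) auto
    also have "\<dots> = (L * s) * (A * (1/2)^k)" by simp
    also have "\<dots> \<le> 1/2 * (A * (1/2)^k)"
      using Ls A_nonneg by (intro mult_right_mono) auto
    finally have "L * norm (?Y - ?Y') \<le> A * (1/2)^Suc k"
      by (simp add: norm_minus_commute)
    then show ?thesis
      using order_trans[OF velocity_step_le[OF u(1)] u(2)] by linarith
  qed
  with cont bound show ?case by blast
qed

lemma velocity_bounds:
  "continuous_on {0..s} (velocity k)"
  "t \<in> {0..s} \<Longrightarrow> norm (velocity k t - v) \<le> 2 * A"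
  "t \<in> {0..s} \<Longrightarrow> norm (velocity (Suc k) t - velocity k t) \<le> A * (1/2)^k"
proof -
  show "continuous_on {0..s} (velocity k)"
    "t \<in> {0..s} \<Longrightarrow> norm (velocity (Suc k) t - velocity k t) \<le> A * (1/2)^k"
    using velocity_bounds_induct[of k] by (simp_all del: velocity.simps)
  assume "t \<in> {0..s}"
  then have "norm (velocity k t - v) \<le> 2 * A * (1 - (1/2)^k)"
    using velocity_bounds_induct[of k] by simp
  also have "\<dots> \<le> 2 * A"
    using A_nonneg by (intro mult_left_le) auto
  finally show "norm (velocity k t - v) \<le> 2 * A" .
qed

lemma velocity_limit:
  obtains w where "continuous_on {0..s} w"
    "\<And>t. t \<in> {0..s} \<Longrightarrow> norm (w t - v) \<le> 2 * A"
    "\<And>t. t \<in> {0..s} \<Longrightarrow> w t \<in> F (path w t)"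
proof -
  have "uniform_limit {0..s} (\<lambda>n t. \<Sum>i<n. velocity (Suc i) t - velocity i t)
      (\<lambda>t. \<Sum>i. velocity (Suc i) t - velocity i t) sequentially"
    by (rule Weierstrass_m_test[OF velocity_bounds(3)]) (auto intro!: summable_mult summable_geometric)
  then have lim_diff: "uniform_limit {0..s} (\<lambda>n t. velocity n t - v)
      (\<lambda>t. \<Sum>i. velocity (Suc i) t - velocity i t) sequentially"
    by (subst (asm) sum_lessThan_telescope) simp
  define w where "w t = (\<Sum>i. velocity (Suc i) t - velocity i t) + v" for t
  have lim: "uniform_limit {0..s} velocity w sequentially"
    using lim_diff unfolding uniform_limit_iff by (simp add: w_def dist_norm algebra_simps)
  show thesis
  proof (rule that)
    show w: "continuous_on {0..s} w"
      by (rule uniform_limit_theorem[OF _ lim]) (simp_all add: velocity_bounds(1))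
    fix t assume t: "t \<in> {0..s}"
    have wt: "(\<lambda>n. velocity n t) \<longlonglongrightarrow> w t" if "t \<in> {0..s}" for t
      using tendsto_uniform_limitI[OF lim that] .
    have wbound: "norm (w t - v) \<le> 2 * A" if "t \<in> {0..s}" for t
      by (rule Lim_bounded[where M = 0 and f = "\<lambda>n. norm (velocity n t - v)"])
        (auto intro!: tendsto_intros wt that velocity_bounds(2))
    then show "norm (w t - v) \<le> 2 * A" using t .
    have "uniform_limit {0..t} velocity w sequentially"
      by (rule uniform_limit_on_subset[OF lim]) (use t in auto)
    then obtain I J where IJ: "\<And>n. (velocity n has_integral I n) {0..t}" "(w has_integral J) {0..t}" "I \<longlonglongrightarrow> J"
      by (rule uniform_limit_integral) (use t in \<open>auto intro: continuous_on_subset[OF velocity_bounds(1)]\<close>)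
    then have path_lim: "(\<lambda>n. path (velocity n) t) \<longlonglongrightarrow> path w t"
      unfolding path_def integral_unique[OF IJ(1)] integral_unique[OF IJ(2)]
      by (intro tendsto_intros IJ(3))
    \<comment> \<open>Each velocity lies in a set that varies with \<open>n\<close>. Replacing it by
      a nearby \<open>u n\<close> in the fixed closed set \<open>F (path w t)\<close> lets
      membership pass to the limit.\<close>
    have "\<exists>u\<in>F (path w t). norm (velocity (Suc n) t - u) \<le> L * norm (path (velocity n) t - path w t)" for n
    proof (rule L)
      show "path (velocity n) t \<in> cball x 1"
        by (rule path_near(2)[OF velocity_bounds(1,2) t])
      show "path w t \<in> cball x 1"
        by (rule path_near(2)[OF w wbound t])
      show "velocity (Suc n) t \<in> F (path (velocity n) t)"
        by (rule velocity_in_F)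
    qed
    then obtain u where u: "\<And>n. u n \<in> F (path w t)"
      "\<And>n. norm (velocity (Suc n) t - u n) \<le> L * norm (path (velocity n) t - path w t)"
      by metis
    have "(\<lambda>n. L * norm (path (velocity n) t - path w t)) \<longlonglongrightarrow> L * norm (path w t - path w t)"
      by (intro tendsto_intros path_lim)
    then have "(\<lambda>n. L * norm (path (velocity n) t - path w t)) \<longlonglongrightarrow> 0" by simp
    moreover have "\<forall>\<^sub>F n in sequentially. norm (velocity (Suc n) t - u n) \<le> L * norm (path (velocity n) t - path w t)"
      using u(2) by (simp del: velocity.simps)
    ultimately have "(\<lambda>n. velocity (Suc n) t - u n) \<longlonglongrightarrow> 0"
      by (rule Lim_null_comparison[rotated])
    from tendsto_diff[OF LIMSEQ_Suc[OF wt[OF t]] this] have "u \<longlonglongrightarrow> w t"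
      by simp
    then show "w t \<in> F (path w t)"
      using closed_sequentially[OF F_closed(1)] u(1) by blast
  qed
qed

lemma backward_trajectory:
  obtains z Y where "trajectory F z s Y" "Y s = y" "norm (z - (y - s *\<^sub>R v)) \<le> 2 * A * s"
proof -
  obtain w where w: "continuous_on {0..s} w"
    "\<And>t. t \<in> {0..s} \<Longrightarrow> norm (w t - v) \<le> 2 * A"
    "\<And>t. t \<in> {0..s} \<Longrightarrow> w t \<in> F (path w t)"
    using velocity_limit by blast
  show thesis
  proof (rule that[of "path w s" "\<lambda>t. path w (s - t)"])
    show "path w (s - s) = y" by (simp add: path_def)
    show "norm (path w s - (y - s *\<^sub>R v)) \<le> 2 * A * s"
      using path_near(1)[OF w(1,2), of s] s_nonneg by simp
    show "trajectory F (path w s) s (\<lambda>t. path w (s - t))"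
      unfolding trajectory_iff
    proof (intro conjI)
      show "abs_continuous_on_Icc 0 s (\<lambda>t. path w (s - t))"
      proof (rule abs_continuous_lipschitz)
        fix a b assume ab: "0 \<le> a" "a \<le> b" "b \<le> s"
        have int: "w integrable_on {0..s - a}"
          using w(1) ab by (intro integrable_continuous_real continuous_on_subset[OF w(1)]) auto
        have "norm (integral {s - b..s - a} w) \<le> (norm v + 2 * A) * ((s - a) - (s - b))"
        proof (rule integral_bound)
          show "continuous_on {s - b..s - a} w"
            using ab by (intro continuous_on_subset[OF w(1)]) auto
          fix t assume "t \<in> {s - b..s - a}"
          then show "norm (w t) \<le> norm v + 2 * A"
            using w(2)[of t] ab norm_triangle_ineq[of "w t - v" v] by simp
        qed (use ab in simp)
        moreover have "path w (s - b) - path w (s - a) = integral {s - b..s - a} w"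
          using Henstock_Kurzweil_Integration.integral_combine[OF _ _ int, of "s - b"] ab by (simp add: path_def algebra_simps)
        ultimately show "norm (path w (s - b) - path w (s - a)) \<le> (norm v + 2 * A) * (b - a)"
          by simp
      qed
      \<comment> \<open>Since \<open>w\<close> is continuous, the empty exceptional set works; the
        sign from reversing time cancels the one in \<open>path\<close>.\<close>
      show "\<exists>N. negligible N \<and> (\<forall>t\<in>{0<..<s} - N. \<exists>u\<in>F (path w (s - t)).
          ((\<lambda>t. path w (s - t)) has_vector_derivative u) (at t))"
      proof (intro exI[of _ "{}"] conjI ballI bexI)
        fix t assume "t \<in> {0<..<s} - {}"
        then have t: "0 < s - t" "s - t < s" by auto
        show "w (s - t) \<in> F (path w (s - t))" using w(3)[of "s - t"] t by simp
        have "((\<lambda>u. integral {0..u} w) has_vector_derivative w (s - t)) (at (s - t) within {0..s})"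
          by (rule integral_has_vector_derivative[OF w(1)]) (use t in simp)
        then have "((\<lambda>u. integral {0..u} w) has_vector_derivative w (s - t)) (at (s - t))"
          using at_within_interior[of "s - t" "{0..s}"] t by simp
        from has_vector_derivative_diff[OF has_vector_derivative_const[of y] this]
        have "(path w has_vector_derivative - w (s - t)) (at (s - t))"
          by (simp add: path_def[abs_def])
        moreover have "((\<lambda>t. s - t) has_vector_derivative - 1) (at t)"
          by (auto intro!: derivative_eq_intros)
        ultimately show "((\<lambda>t. path w (s - t)) has_vector_derivative w (s - t)) (at t)"
          using vector_diff_chain_at[of "\<lambda>t. s - t" "- 1" t "path w" "- w (s - t)"] by (simp add: o_def)
      qed simp
    qed simp
  qed
qed

end

text \<open>The constant velocity \<open>v\<close> is wrong by an amount of order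
  \<open>norm (y - x) + s\<close>, which integrates to this amount times \<open>s\<close>.
  Uniformity in \<open>y\<close> serves the lift of normals, where every \<open>y\<close> near
  \<open>x\<close> is an end point.\<close>

lemma backward_trajectory_exists:
  assumes F: "assumption_F (F :: 'a::euclidean_space \<Rightarrow> 'a set)" and v: "v \<in> F x"
  obtains \<delta> M where "\<delta> > 0" "M > 0"
    "\<And>y s. \<lbrakk>norm (y - x) \<le> \<delta>; 0 \<le> s; s \<le> \<delta>\<rbrakk> \<Longrightarrow>
      \<exists>z Y. trajectory F z s Y \<and> Y s = y \<and> norm (z - (y - s *\<^sub>R v)) \<le> M * s * (norm (y - x) + s)"
proof -
  obtain L where "L > 0" and L:
    "\<And>y z v. \<lbrakk>y \<in> cball x 1; z \<in> cball x 1; v \<in> F y\<rbrakk> \<Longrightarrow> \<exists>w\<in>F z. norm (v - w) \<le> L * norm (y - z)"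
    using assumption_F_lipschitz[OF F compact_cball] by metis
  define V where "V = 1 + norm v"
  have "V > 0" "norm v \<le> V" "1 \<le> V" by (auto simp: V_def add_pos_nonneg)
  \<comment> \<open>\<open>1 / (2 * L)\<close> gives the contraction ratio, and
    \<open>1 / (2 * V)\<close> gives the smallness condition, whose left side is at most
    \<open>\<delta> * (2 * V)\<close>.\<close>
  define \<delta> where "\<delta> = min (1 / (2 * L)) (1 / (2 * V))"
  have "\<delta> > 0" "L * \<delta> \<le> 1 / 2" "\<delta> * (2 * V) \<le> 1"
    using \<open>L > 0\<close> \<open>V > 0\<close> by (auto simp: \<delta>_def min_def field_simps)
  show thesis
  proof (rule that[of \<delta> "2 * L * V"])
    fix y s assume ys: "norm (y - x) \<le> \<delta>" "0 \<le> s" "s \<le> \<delta>"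
    let ?A = "L * (norm (y - x) + s * norm v)"
    have "norm (y - x) + s * norm v \<le> \<delta> + \<delta> * norm v"
      using ys by (intro add_mono mult_right_mono) auto
    also have "\<dots> = \<delta> * V" by (simp add: V_def algebra_simps)
    finally have "?A \<le> L * (\<delta> * V)" using \<open>L > 0\<close> by simp
    also have "\<dots> = (L * \<delta>) * V" by simp
    also have "\<dots> \<le> 1 / 2 * V" using \<open>L * \<delta> \<le> 1 / 2\<close> \<open>V > 0\<close> by (intro mult_right_mono) auto
    finally have A: "2 * ?A \<le> V" by simp
    have "L * s \<le> L * \<delta>" using ys \<open>L > 0\<close> by simp
    interpret filippov_iteration F x v y L s
    proof
      have "s * (norm v + 2 * ?A) \<le> \<delta> * (norm v + V)"
        using A ys \<open>L > 0\<close> by (intro mult_mono) auto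
      then have "norm (y - x) + s * (norm v + 2 * ?A) \<le> \<delta> + \<delta> * (norm v + V)"
        using ys by linarith
      also have "\<dots> = \<delta> * (2 * V)" by (simp add: V_def algebra_simps)
      finally show "norm (y - x) + s * (norm v + 2 * ?A) \<le> 1"
        using \<open>\<delta> * (2 * V) \<le> 1\<close> by linarith
    qed (use F v L \<open>L > 0\<close> ys order_trans[OF \<open>L * s \<le> L * \<delta>\<close> \<open>L * \<delta> \<le> 1 / 2\<close>] in auto)
    obtain z Y where "trajectory F z s Y" "Y s = y" and z: "norm (z - (y - s *\<^sub>R v)) \<le> 2 * ?A * s"
      using backward_trajectory[unfolded A_def] by blast
    have "norm (y - x) + s * norm v \<le> V * (norm (y - x) + s)"
      using \<open>1 \<le> V\<close> \<open>norm v \<le> V\<close> ys(2) mult_right_mono[of 1 V "norm (y - x)"]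
        mult_left_mono[of "norm v" V s] by (simp add: algebra_simps)
    then have "2 * ?A * s \<le> 2 * (L * (V * (norm (y - x) + s))) * s"
      using \<open>L > 0\<close> ys(2) by (intro mult_right_mono mult_left_mono) auto
    also have "\<dots> = 2 * L * V * s * (norm (y - x) + s)" by simp
    finally have "norm (z - (y - s *\<^sub>R v)) \<le> 2 * L * V * s * (norm (y - x) + s)"
      using z by (rule order_trans[rotated])
    with \<open>trajectory F z s Y\<close> \<open>Y s = y\<close>
    show "\<exists>z Y. trajectory F z s Y \<and> Y s = y \<and>
        norm (z - (y - s *\<^sub>R v)) \<le> 2 * L * V * s * (norm (y - x) + s)"
      by blast
  qed (use \<open>\<delta> > 0\<close> \<open>L > 0\<close> \<open>V > 0\<close> in auto)
qed

section \<open>Proximal normals to sublevel sets and to the epigraph\<close>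

text \<open>At distance at least \<open>\<delta>\<close> the inequality comes for free from
  Cauchy-Schwarz, with constant \<open>norm v / \<delta>\<close>.\<close>

lemma proximal_normal_coneI_local:
  assumes "\<delta> > 0" "\<And>y. \<lbrakk>y \<in> E; norm (y - x) < \<delta>\<rbrakk> \<Longrightarrow> v \<bullet> (y - x) \<le> \<sigma> * (norm (y - x))\<^sup>2"
  shows "v \<in> proximal_normal_cone E x"
proof -
  define \<sigma>' where "\<sigma>' = \<bar>\<sigma>\<bar> + norm v / \<delta>"
  have "v \<bullet> (y - x) \<le> \<sigma>' * (norm (y - x))\<^sup>2" if "y \<in> E" for y
  proof (cases "norm (y - x) < \<delta>")
    case True
    have "v \<bullet> (y - x) \<le> \<sigma> * (norm (y - x))\<^sup>2" using assms(2) that True .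
    also have "\<dots> \<le> \<sigma>' * (norm (y - x))\<^sup>2"
      using \<open>\<delta> > 0\<close> by (intro mult_right_mono) (auto simp: \<sigma>'_def intro: add_increasing2)
    finally show ?thesis .
  next
    case False
    have "v \<bullet> (y - x) \<le> norm v * norm (y - x) * 1" by (simp add: norm_cauchy_schwarz)
    also have "\<dots> \<le> norm v * norm (y - x) * (norm (y - x) / \<delta>)"
      using False \<open>\<delta> > 0\<close> by (intro mult_left_mono) auto
    also have "\<dots> = norm v / \<delta> * (norm (y - x))\<^sup>2" by (simp add: power2_eq_square)
    also have "\<dots> \<le> \<sigma>' * (norm (y - x))\<^sup>2"
      by (intro mult_right_mono) (auto simp: \<sigma>'_def)
    finally show ?thesis .
  qed
  moreover have "\<sigma>' \<ge> 0" using \<open>\<delta> > 0\<close> by (simp add: \<sigma>'_def)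
  ultimately show ?thesis unfolding proximal_normal_cone_def by blast
qed

lemma proximal_normal_coneE:
  assumes "v \<in> proximal_normal_cone E x"
  obtains \<sigma> where "\<sigma> \<ge> 0" "\<And>y. y \<in> E \<Longrightarrow> v \<bullet> (y - x) \<le> \<sigma> * (norm (y - x))\<^sup>2"
  using assms unfolding proximal_normal_cone_def by blast

lemma zero_in_proximal_normal_cone: "0 \<in> proximal_normal_cone E x"
  unfolding proximal_normal_cone_def by (auto intro: exI[of _ 0])

lemma proximal_normal_cone_add:
  assumes "v \<in> proximal_normal_cone E x" "w \<in> proximal_normal_cone E x"
  shows "v + w \<in> proximal_normal_cone E x"
proof -
  obtain \<sigma> where \<sigma>: "\<sigma> \<ge> 0" "\<And>y. y \<in> E \<Longrightarrow> v \<bullet> (y - x) \<le> \<sigma> * (norm (y - x))\<^sup>2"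
    using assms(1) by (rule proximal_normal_coneE) blast
  obtain \<tau> where \<tau>: "\<tau> \<ge> 0" "\<And>y. y \<in> E \<Longrightarrow> w \<bullet> (y - x) \<le> \<tau> * (norm (y - x))\<^sup>2"
    using assms(2) by (rule proximal_normal_coneE) blast
  have "(v + w) \<bullet> (y - x) \<le> (\<sigma> + \<tau>) * (norm (y - x))\<^sup>2" if "y \<in> E" for y
    using add_mono[OF \<sigma>(2)[OF that] \<tau>(2)[OF that]] by (simp add: inner_add_left distrib_right)
  then show ?thesis
    unfolding proximal_normal_cone_def using \<sigma>(1) \<tau>(1) by (auto intro!: exI[of _ "\<sigma> + \<tau>"])
qed

lemma proximal_normal_cone_scaleR:
  assumes "v \<in> proximal_normal_cone E x" "c \<ge> 0"
  shows "c *\<^sub>R v \<in> proximal_normal_cone E x"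
proof -
  obtain \<sigma> where \<sigma>: "\<sigma> \<ge> 0" "\<And>y. y \<in> E \<Longrightarrow> v \<bullet> (y - x) \<le> \<sigma> * (norm (y - x))\<^sup>2"
    using assms(1) by (rule proximal_normal_coneE) blast
  have "(c *\<^sub>R v) \<bullet> (y - x) \<le> (c * \<sigma>) * (norm (y - x))\<^sup>2" if "y \<in> E" for y
    using mult_left_mono[OF \<sigma>(2)[OF that] \<open>c \<ge> 0\<close>] by (simp add: mult.assoc)
  then show ?thesis
    unfolding proximal_normal_cone_def using \<sigma>(1) \<open>c \<ge> 0\<close> by (auto intro!: exI[of _ "c * \<sigma>"])
qed

text \<open>The span of a convex cone is \<open>N - N\<close>, so a span vector with first component
  0 is a difference of two elements of \<open>N\<close> over the same point. Uniqueness without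
  convexity would admit graphs of nonlinear functions, whose span can be larger than that of the
  domain.\<close>

lemma dim_fst_image_convex_cone:
  fixes N :: "('a::euclidean_space \<times> real) set"
  assumes zero: "0 \<in> N" and add: "\<And>p q. \<lbrakk>p \<in> N; q \<in> N\<rbrakk> \<Longrightarrow> p + q \<in> N"
    and scale: "\<And>p c. \<lbrakk>p \<in> N; c \<ge> 0\<rbrakk> \<Longrightarrow> c *\<^sub>R p \<in> N"
    and unique: "\<And>\<zeta> a b. \<lbrakk>(\<zeta>, a) \<in> N; (\<zeta>, b) \<in> N\<rbrakk> \<Longrightarrow> a = b"
  shows "dim (fst ` N) = dim N"
proof -
  have span: "\<exists>p\<in>N. \<exists>q\<in>N. z = p - q" if "z \<in> span N" for z
    using that
  proof (induction rule: span_induct_alt)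
    case base
    show ?case using zero by (intro bexI[of _ 0]) auto
  next
    case (step c n z)
    then obtain p q where pq: "p \<in> N" "q \<in> N" "z = p - q" by blast
    show ?case
    proof (cases "c \<ge> 0")
      case True
      have "c *\<^sub>R n + z = (c *\<^sub>R n + p) - q" using pq(3) by simp
      then show ?thesis using add[OF scale[OF step(1) True] pq(1)] pq(2) by blast
    next
      case False
      then have "(- c) *\<^sub>R n + q \<in> N" using add[OF scale[OF step(1), of "- c"] pq(2)] by simp
      moreover have "c *\<^sub>R n + z = p - ((- c) *\<^sub>R n + q)" using pq(3) by simp
      ultimately show ?thesis using pq(1) by blast
    qed
  qed
  have "inj_on fst (span N)"
  proof (rule inj_onI)
    fix z z' assume z: "z \<in> span N" "z' \<in> span N" "fst z = fst z'"
    then have "z - z' \<in> span N" by (intro span_diff)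
    then obtain p q where pq: "p \<in> N" "q \<in> N" "z - z' = p - q" using span by blast
    then have "fst p = fst q" using z(3) by (simp add: prod_eq_iff)
    then have "(fst p, snd q) \<in> N" using pq(2) by simp
    moreover have "(fst p, snd p) \<in> N" using pq(1) by simp
    ultimately have "snd p = snd q" by (intro unique)
    with \<open>fst p = fst q\<close> pq(3) show "z = z'" by (simp add: prod_eq_iff)
  qed
  then show ?thesis using dim_image_eq[OF linear_fst] by blast
qed

lemma nonpos_if_le_small:
  fixes a C :: real
  assumes "\<delta> > 0" "\<And>s. \<lbrakk>0 < s; s \<le> \<delta>\<rbrakk> \<Longrightarrow> a \<le> C * s"
  shows "a \<le> 0"
proof (rule tendsto_le[OF _ _ tendsto_const])
  show "((\<lambda>s. C * s) \<longlongrightarrow> 0) (at_right 0)"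
    by (auto intro!: tendsto_eq_intros)
  show "\<forall>\<^sub>F s in at_right 0. a \<le> C * s"
    using assms by (auto simp: eventually_at_right_field intro!: exI[of _ \<delta>])
qed simp

section \<open>First-order conditions satisfied by epigraph normals\<close>

text \<open>Only points at the height \<open>r\<close> are tested: that slice of the epigraph is the
  sublevel set.\<close>

lemma fst_proximal_normal_epigraph:
  assumes "min_time F K x = ereal r"
    and N: "(\<zeta>, \<mu>) \<in> proximal_normal_cone (ereal_epigraph (min_time F K)) (x, r)"
  shows "\<zeta> \<in> proximal_normal_cone (controllable_set_upto F K r) x"
proof -
  obtain \<sigma> where "\<sigma> \<ge> 0" and \<sigma>: "\<And>p. p \<in> ereal_epigraph (min_time F K) \<Longrightarrow>
      (\<zeta>, \<mu>) \<bullet> (p - (x, r)) \<le> \<sigma> * (norm (p - (x, r)))\<^sup>2"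
    using N by (rule proximal_normal_coneE) blast
  have "\<zeta> \<bullet> (y - x) \<le> \<sigma> * (norm (y - x))\<^sup>2" if "y \<in> controllable_set_upto F K r" for y
  proof -
    have "(y, r) \<in> ereal_epigraph (min_time F K)"
      using that le_less_trans[of "min_time F K y" "ereal r" \<infinity>]
      by (auto simp: ereal_epigraph_def controllable_set_upto_def)
    from \<sigma>[OF this] show ?thesis by (simp add: norm_Pair)
  qed
  then show ?thesis using \<open>\<sigma> \<ge> 0\<close> unfolding proximal_normal_cone_def by blast
qed

lemma epigraph_normal_inequality:
  assumes N: "(\<zeta>, \<mu>) \<in> proximal_normal_cone (ereal_epigraph (min_time F K)) (x, r)"
  obtains \<sigma> where "\<sigma> \<ge> 0" "\<And>y \<beta>. min_time F K y \<le> ereal \<beta> \<Longrightarrow>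
      \<zeta> \<bullet> (y - x) + \<mu> * (\<beta> - r) \<le> \<sigma> * ((norm (y - x))\<^sup>2 + (\<beta> - r)\<^sup>2)"
proof -
  obtain \<sigma> where "\<sigma> \<ge> 0" and \<sigma>: "\<And>p. p \<in> ereal_epigraph (min_time F K) \<Longrightarrow>
      (\<zeta>, \<mu>) \<bullet> (p - (x, r)) \<le> \<sigma> * (norm (p - (x, r)))\<^sup>2"
    using N by (rule proximal_normal_coneE) blast
  show thesis
  proof (rule that[OF \<open>\<sigma> \<ge> 0\<close>])
    fix y \<beta> assume "min_time F K y \<le> ereal \<beta>"
    then have "(y, \<beta>) \<in> ereal_epigraph (min_time F K)"
      using le_less_trans[of "min_time F K y" "ereal \<beta>" \<infinity>] by (auto simp: ereal_epigraph_def)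
    from \<sigma>[OF this] show "\<zeta> \<bullet> (y - x) + \<mu> * (\<beta> - r) \<le> \<sigma> * ((norm (y - x))\<^sup>2 + (\<beta> - r)\<^sup>2)"
      by (simp add: norm_Pair)
  qed
qed

lemma epigraph_normal_le:
  assumes F: "assumption_F (F :: 'a::euclidean_space \<Rightarrow> 'a set)" and r: "min_time F K x = ereal r"
    and N: "(\<zeta>, \<mu>) \<in> proximal_normal_cone (ereal_epigraph (min_time F K)) (x, r)"
    and v: "v \<in> F x"
  shows "\<mu> \<le> \<zeta> \<bullet> v"
proof -
  obtain \<sigma> where "\<sigma> \<ge> 0" and \<sigma>: "\<And>y \<beta>. min_time F K y \<le> ereal \<beta> \<Longrightarrow>
      \<zeta> \<bullet> (y - x) + \<mu> * (\<beta> - r) \<le> \<sigma> * ((norm (y - x))\<^sup>2 + (\<beta> - r)\<^sup>2)"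
    using N by (rule epigraph_normal_inequality) blast
  obtain \<delta> M where "\<delta> > 0" "M > 0" and backward:
    "\<And>y s. \<lbrakk>norm (y - x) \<le> \<delta>; 0 \<le> s; s \<le> \<delta>\<rbrakk> \<Longrightarrow>
      \<exists>z Y. trajectory F z s Y \<and> Y s = y \<and> norm (z - (y - s *\<^sub>R v)) \<le> M * s * (norm (y - x) + s)"
    using backward_trajectory_exists[OF F v] by metis
  have "\<mu> - \<zeta> \<bullet> v \<le> 0"
  proof (rule nonpos_if_le_small)
    show "min \<delta> 1 > 0" using \<open>\<delta> > 0\<close> by simp
    fix s :: real assume s: "0 < s" "s \<le> min \<delta> 1"
    then obtain z Y where Y: "trajectory F z s Y" "Y s = x"
      and z: "norm (z - (x - s *\<^sub>R v)) \<le> M * s * s"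
      using backward[of x s] \<open>\<delta> > 0\<close> by auto
    \<comment> \<open>Hence \<open>(z, s + r)\<close> is a test point. To first order it changes
      \<open>\<zeta>\<close> by \<open>- s * (\<zeta> \<bullet> v)\<close> and the height by
      \<open>s\<close>; all else is of order \<open>s\<^sup>2\<close>.\<close>
    have "min_time F K z \<le> ereal (s + r)"
      using min_time_append[OF Y(1), of K r] Y(2) r s by simp
    from \<sigma>[OF this] have ineq: "\<zeta> \<bullet> (z - x) + \<mu> * s \<le> \<sigma> * ((norm (z - x))\<^sup>2 + s\<^sup>2)"
      by simp
    define e where "e = z - (x - s *\<^sub>R v)"
    have zx: "z - x = e - s *\<^sub>R v" by (simp add: e_def)
    have e: "norm e \<le> M * s * s" using z by (simp add: e_def)
    have "M * s * s \<le> M * s * 1" using s \<open>M > 0\<close> by (intro mult_left_mono) auto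
    then have "norm (z - x) \<le> (M + norm v) * s"
      using norm_triangle_ineq4[of e "s *\<^sub>R v"] e s unfolding zx by (simp add: algebra_simps)
    then have "(norm (z - x))\<^sup>2 \<le> ((M + norm v) * s)\<^sup>2" by (intro power_mono) auto
    then have "\<sigma> * ((norm (z - x))\<^sup>2 + s\<^sup>2) \<le> \<sigma> * (((M + norm v) * s)\<^sup>2 + s\<^sup>2)"
      using \<open>\<sigma> \<ge> 0\<close> by (intro mult_left_mono) auto
    also have "\<dots> = \<sigma> * ((M + norm v)\<^sup>2 + 1) * s * s"
      by (simp add: power2_eq_square algebra_simps)
    finally have "\<zeta> \<bullet> (z - x) + \<mu> * s \<le> \<sigma> * ((M + norm v)\<^sup>2 + 1) * s * s"
      using ineq by linarith
    moreover have "\<zeta> \<bullet> (z - x) \<ge> - (norm \<zeta> * (M * s * s)) - s * (\<zeta> \<bullet> v)"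
      using Cauchy_Schwarz_ineq2[of \<zeta> e] mult_left_mono[OF e, of "norm \<zeta>"]
      unfolding zx by (simp add: inner_diff_right)
    ultimately have "(\<mu> - \<zeta> \<bullet> v) * s \<le> (\<sigma> * ((M + norm v)\<^sup>2 + 1) + norm \<zeta> * M) * s * s"
      by (simp add: algebra_simps)
    then show "\<mu> - \<zeta> \<bullet> v \<le> (\<sigma> * ((M + norm v)\<^sup>2 + 1) + norm \<zeta> * M) * s"
      using s by simp
  qed
  then show ?thesis by simp
qed

text \<open>Moving for time \<open>s\<close> along a nearly optimal trajectory lowers the height by
  about \<open>s\<close> and raises \<open>\<zeta>\<close> by about \<open>c * s\<close> or more.
  With \<open>c\<close> an arbitrary lower bound, the lemma can be applied to the last component of
  another normal.\<close>

lemma epigraph_normal_ge: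
  assumes F: "assumption_F (F :: 'a::euclidean_space \<Rightarrow> 'a set)" and r: "min_time F K x = ereal r" "r > 0"
    and N: "(\<zeta>, \<mu>) \<in> proximal_normal_cone (ereal_epigraph (min_time F K)) (x, r)"
    and c: "\<And>v. v \<in> F x \<Longrightarrow> c \<le> \<zeta> \<bullet> v"
  shows "c \<le> \<mu>"
proof -
  obtain \<sigma> where "\<sigma> \<ge> 0" and \<sigma>: "\<And>y \<beta>. min_time F K y \<le> ereal \<beta> \<Longrightarrow>
      \<zeta> \<bullet> (y - x) + \<mu> * (\<beta> - r) \<le> \<sigma> * ((norm (y - x))\<^sup>2 + (\<beta> - r)\<^sup>2)"
    using N by (rule epigraph_normal_inequality) blast
  obtain \<delta> M where "\<delta> > 0" "M > 0"
    and near: "\<And>y0 T y t. \<lbrakk>norm (y0 - x) \<le> \<delta>; trajectory F y0 T y; 0 \<le> t; t \<le> T; t \<le> \<delta>\<rbrakk>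
      \<Longrightarrow> norm (y t - y0) \<le> M * t"
    and growth: "\<And>y0 T y t \<zeta> c. \<lbrakk>norm (y0 - x) \<le> \<delta>; trajectory F y0 T y; 0 \<le> t; t \<le> T; t \<le> \<delta>;
        \<And>v. v \<in> F x \<Longrightarrow> c \<le> \<zeta> \<bullet> v\<rbrakk>
      \<Longrightarrow> (c - norm \<zeta> * M * (norm (y0 - x) + t)) * t \<le> \<zeta> \<bullet> (y t - y0)"
    using trajectory_local_estimate[OF F, of x] by metis
  have "c - \<mu> \<le> 0"
  proof (rule nonpos_if_le_small)
    show "min \<delta> (min 1 r) > 0" using \<open>\<delta> > 0\<close> \<open>r > 0\<close> by simp
    fix s :: real assume s: "0 < s" "s \<le> min \<delta> (min 1 r)"
    \<comment> \<open>The surplus must be \<open>s\<^sup>2\<close>: a surplus of order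
      \<open>s\<close> would disturb the first-order balance. The bounds \<open>s \<le> 1\<close>
      and \<open>s \<le> r\<close> give \<open>s\<^sup>2 \<le> s\<close> and a curve still defined
      at time \<open>s\<close>.\<close>
    have "min_time F K x < ereal (r + s\<^sup>2)" using r s by simp
    then obtain T y where y: "T < r + s\<^sup>2" "trajectory F x T y" "y T \<in> K" "T \<ge> 0"
      unfolding min_time_less_iff by blast
    have "\<not> T < r" using y r min_time_less_iff[of F K x r] by auto
    then have sT: "s \<le> T" using s by simp
    have "min_time F K (y s) \<le> ereal (T - s)"
      using min_time_along[OF y(2,3)] s sT by simp
    also have "\<dots> \<le> ereal (r + s\<^sup>2 - s)" using y(1) by simp
    finally have "\<zeta> \<bullet> (y s - x) + \<mu> * (s\<^sup>2 - s) \<le> \<sigma> * ((norm (y s - x))\<^sup>2 + (s\<^sup>2 - s)\<^sup>2)"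
      using \<sigma>[of "y s" "r + s\<^sup>2 - s"] by simp
    also have "\<dots> \<le> \<sigma> * ((M * s)\<^sup>2 + s\<^sup>2)"
    proof (intro mult_left_mono add_mono)
      show "(norm (y s - x))\<^sup>2 \<le> (M * s)\<^sup>2"
        using near[OF _ y(2), of s] s sT \<open>\<delta> > 0\<close> by (intro power_mono) auto
      have "s\<^sup>2 \<le> s * 1" using s unfolding power2_eq_square by (intro mult_left_mono) auto
      then have "\<bar>s\<^sup>2 - s\<bar> \<le> \<bar>s\<bar>" using s by (auto simp: abs_le_iff)
      then show "(s\<^sup>2 - s)\<^sup>2 \<le> s\<^sup>2" by (rule abs_le_square_iff[THEN iffD1])
    qed (use \<open>\<sigma> \<ge> 0\<close> in auto)
    also have "\<dots> = \<sigma> * (M\<^sup>2 + 1) * s * s" by (simp add: power2_eq_square algebra_simps)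
    finally have "\<zeta> \<bullet> (y s - x) + \<mu> * (s\<^sup>2 - s) \<le> \<sigma> * (M\<^sup>2 + 1) * s * s" .
    moreover have "(c - norm \<zeta> * M * s) * s \<le> \<zeta> \<bullet> (y s - x)"
      using growth[OF _ y(2), of s c \<zeta>] s sT \<open>\<delta> > 0\<close> c by simp
    moreover have "- \<mu> * (s * s) \<le> \<bar>\<mu>\<bar> * (s * s)" by (intro mult_right_mono) auto
    ultimately have "(c - \<mu>) * s \<le> (\<sigma> * (M\<^sup>2 + 1) + norm \<zeta> * M + \<bar>\<mu>\<bar>) * s * s"
      by (simp add: power2_eq_square algebra_simps)
    then show "c - \<mu> \<le> (\<sigma> * (M\<^sup>2 + 1) + norm \<zeta> * M + \<bar>\<mu>\<bar>) * s"
      using s by simp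
  qed
  then show ?thesis by simp
qed

section \<open>Lifting sublevel normals to the epigraph\<close>

text \<open>Nearly optimal trajectories from \<open>x\<close> enter the sublevel set, where a
  proximal normal allows no first-order increase of \<open>\<zeta>\<close>. In the lift, this sign
  settles points of the sublevel set taken at heights above \<open>r\<close>.\<close>

lemma sublevel_normal_min_nonpos:
  assumes F: "assumption_F (F :: 'a::euclidean_space \<Rightarrow> 'a set)" and r: "min_time F K x = ereal r" "r > 0"
    and N: "\<zeta> \<in> proximal_normal_cone (controllable_set_upto F K r) x"
    and \<mu>: "\<And>v. v \<in> F x \<Longrightarrow> \<mu> \<le> \<zeta> \<bullet> v"
  shows "\<mu> \<le> 0"
proof -
  obtain \<sigma> where "\<sigma> \<ge> 0" and \<sigma>: "\<And>y. y \<in> controllable_set_upto F K r \<Longrightarrow>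
      \<zeta> \<bullet> (y - x) \<le> \<sigma> * (norm (y - x))\<^sup>2"
    using N by (rule proximal_normal_coneE) blast
  obtain \<delta> M where "\<delta> > 0" "M > 0"
    and near: "\<And>y0 T y t. \<lbrakk>norm (y0 - x) \<le> \<delta>; trajectory F y0 T y; 0 \<le> t; t \<le> T; t \<le> \<delta>\<rbrakk>
      \<Longrightarrow> norm (y t - y0) \<le> M * t"
    and growth: "\<And>y0 T y t \<zeta> c. \<lbrakk>norm (y0 - x) \<le> \<delta>; trajectory F y0 T y; 0 \<le> t; t \<le> T; t \<le> \<delta>;
        \<And>v. v \<in> F x \<Longrightarrow> c \<le> \<zeta> \<bullet> v\<rbrakk>
      \<Longrightarrow> (c - norm \<zeta> * M * (norm (y0 - x) + t)) * t \<le> \<zeta> \<bullet> (y t - y0)"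
    using trajectory_local_estimate[OF F, of x] by metis
  show ?thesis
  proof (rule nonpos_if_le_small)
    show "min \<delta> r > 0" using \<open>\<delta> > 0\<close> \<open>r > 0\<close> by simp
    fix s :: real assume s: "0 < s" "s \<le> min \<delta> r"
    \<comment> \<open>A surplus below \<open>s\<close> is enough: at time \<open>s\<close> the
      remaining time is less than \<open>r\<close>.\<close>
    have "min_time F K x < ereal (r + s)" using r s by simp
    then obtain T y where y: "T < r + s" "trajectory F x T y" "y T \<in> K" "T \<ge> 0"
      unfolding min_time_less_iff by blast
    have "\<not> T < r" using y r min_time_less_iff[of F K x r] by auto
    then have sT: "s \<le> T" using s by simp
    have "min_time F K (y s) \<le> ereal (T - s)"
      using min_time_along[OF y(2,3)] s sT by simp
    also have "\<dots> \<le> ereal r" using y(1) by simp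
    finally have "\<zeta> \<bullet> (y s - x) \<le> \<sigma> * (norm (y s - x))\<^sup>2"
      by (intro \<sigma>) (simp add: controllable_set_upto_def)
    also have "\<dots> \<le> \<sigma> * (M * s)\<^sup>2"
      using near[OF _ y(2), of s] s sT \<open>\<delta> > 0\<close> \<open>\<sigma> \<ge> 0\<close> by (intro mult_left_mono power_mono) auto
    finally have "(\<mu> - norm \<zeta> * M * s) * s \<le> \<sigma> * (M * s)\<^sup>2"
      using growth[OF _ y(2), of s \<mu> \<zeta>] s sT \<open>\<delta> > 0\<close> \<mu> by simp
    then have "\<mu> * s \<le> (\<sigma> * M\<^sup>2 + norm \<zeta> * M) * s * s"
      by (simp add: power2_eq_square algebra_simps)
    then show "\<mu> \<le> (\<sigma> * M\<^sup>2 + norm \<zeta> * M) * s"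
      using s by simp
  qed
qed

text \<open>A point \<open>y\<close> is carried to the sublevel set so that the given normal can be
  tested there: from a height below \<open>r\<close> backwards with velocity about \<open>v\<close>,
  from a level above \<open>r\<close> forwards for just over the excess time. Either motion changes
  \<open>\<zeta>\<close> to first order by the required multiple of \<open>\<mu>\<close>, backwards
  exactly and forwards at least, by minimality of \<open>v\<close>.\<close>

lemma sublevel_normal_lifts:
  assumes F: "assumption_F (F :: 'a::euclidean_space \<Rightarrow> 'a set)" and r: "min_time F K x = ereal r" "r > 0"
    and N: "\<zeta> \<in> proximal_normal_cone (controllable_set_upto F K r) x"
    and v: "v \<in> F x" and v_min: "\<And>u. u \<in> F x \<Longrightarrow> \<zeta> \<bullet> v \<le> \<zeta> \<bullet> u"
  shows "(\<zeta>, \<zeta> \<bullet> v) \<in> proximal_normal_cone (ereal_epigraph (min_time F K)) (x, r)"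
proof -
  define \<mu> where "\<mu> = \<zeta> \<bullet> v"
  have "\<mu> \<le> 0"
    using sublevel_normal_min_nonpos[OF F r N] v_min by (simp add: \<mu>_def)
  obtain \<sigma> where "\<sigma> \<ge> 0" and \<sigma>: "\<And>y. min_time F K y \<le> ereal r \<Longrightarrow>
      \<zeta> \<bullet> (y - x) \<le> \<sigma> * (norm (y - x))\<^sup>2"
    using N by (rule proximal_normal_coneE) (auto simp: controllable_set_upto_def)
  obtain \<delta>1 M1 where "\<delta>1 > 0" "M1 > 0"
    and near: "\<And>y0 T y t. \<lbrakk>norm (y0 - x) \<le> \<delta>1; trajectory F y0 T y; 0 \<le> t; t \<le> T; t \<le> \<delta>1\<rbrakk>
      \<Longrightarrow> norm (y t - y0) \<le> M1 * t"
    and growth: "\<And>y0 T y t \<zeta> c. \<lbrakk>norm (y0 - x) \<le> \<delta>1; trajectory F y0 T y; 0 \<le> t; t \<le> T; t \<le> \<delta>1;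
        \<And>v. v \<in> F x \<Longrightarrow> c \<le> \<zeta> \<bullet> v\<rbrakk>
      \<Longrightarrow> (c - norm \<zeta> * M1 * (norm (y0 - x) + t)) * t \<le> \<zeta> \<bullet> (y t - y0)"
    using trajectory_local_estimate[OF F, of x] by metis
  obtain \<delta>2 M2 where "\<delta>2 > 0" "M2 > 0" and backward:
    "\<And>y s. \<lbrakk>norm (y - x) \<le> \<delta>2; 0 \<le> s; s \<le> \<delta>2\<rbrakk> \<Longrightarrow>
      \<exists>z Y. trajectory F z s Y \<and> Y s = y \<and> norm (z - (y - s *\<^sub>R v)) \<le> M2 * s * (norm (y - x) + s)"
    using backward_trajectory_exists[OF F v] by metis
  \<comment> \<open>The squares bound the distance of the carried point from \<open>x\<close>.
    \<open>norm \<zeta> * M2\<close> pays for the backward error, the factor 4 for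
    \<open>(2 * ?d) * (2 * ?d)\<close>, and \<open>\<bar>\<mu>\<bar>\<close> for the surplus
    \<open>s\<^sup>2\<close>.\<close>
  define C1 where "C1 = \<sigma> * (1 + norm v + M2)\<^sup>2 + norm \<zeta> * M2"
  define C2 where "C2 = \<sigma> * (1 + 2 * M1)\<^sup>2 + norm \<zeta> * M1 * 4 + \<bar>\<mu>\<bar>"
  have "C1 \<ge> 0" "C2 \<ge> 0" "\<sigma> \<le> C2"
  proof -
    have "\<sigma> * 1 \<le> \<sigma> * (1 + 2 * M1)\<^sup>2"
      using \<open>\<sigma> \<ge> 0\<close> \<open>M1 > 0\<close> by (intro mult_left_mono one_le_power) auto
    moreover have "0 \<le> norm \<zeta> * M1 * 4" using \<open>M1 > 0\<close> by simp
    ultimately show "\<sigma> \<le> C2" unfolding C2_def by linarith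
  qed (use \<open>\<sigma> \<ge> 0\<close> \<open>M1 > 0\<close> \<open>M2 > 0\<close> in \<open>auto simp: C1_def C2_def\<close>)
  \<comment> \<open>Halving leaves room for the forward time
    \<open>s + s\<^sup>2 \<le> 2 * s\<close> below both \<open>\<delta>1\<close> and
    \<open>r\<close>.\<close>
  define \<delta> where "\<delta> = min (min \<delta>1 \<delta>2) (min 1 r) / 2"
  have \<delta>: "\<delta> > 0" "2 * \<delta> \<le> \<delta>1" "\<delta> \<le> \<delta>1" "\<delta> \<le> \<delta>2" "\<delta> \<le> 1" "2 * \<delta> \<le> r"
    using \<open>\<delta>1 > 0\<close> \<open>\<delta>2 > 0\<close> \<open>r > 0\<close> by (auto simp: \<delta>_def)
  have below: "\<zeta> \<bullet> (y - x) - \<mu> * s \<le> C1 * (norm (y - x) + s)\<^sup>2"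
    if y: "norm (y - x) \<le> \<delta>" "0 \<le> s" "s \<le> \<delta>" "min_time F K y \<le> ereal (r - s)" for y s
  proof -
    let ?d = "norm (y - x) + s"
    obtain z Y where Y: "trajectory F z s Y" "Y s = y"
      and z: "norm (z - (y - s *\<^sub>R v)) \<le> M2 * s * ?d"
      using backward[of y s] y \<delta> by auto
    define e where "e = z - (y - s *\<^sub>R v)"
    have zx: "z - x = (y - x) + (e - s *\<^sub>R v)" by (simp add: e_def)
    have e: "norm e \<le> M2 * s * ?d" using z by (simp add: e_def)
    have "min_time F K z \<le> ereal (s + (r - s))"
      using min_time_append[OF Y(1), of K "r - s"] Y(2) y by simp
    then have "\<zeta> \<bullet> (z - x) \<le> \<sigma> * (norm (z - x))\<^sup>2" by (intro \<sigma>) simp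
    also have "\<dots> \<le> \<sigma> * ((1 + norm v + M2) * ?d)\<^sup>2"
    proof (intro mult_left_mono power_mono)
      have "M2 * s * ?d \<le> M2 * 1 * ?d"
        using y \<delta> \<open>M2 > 0\<close> by (intro mult_right_mono mult_left_mono) auto
      moreover have "s * norm v \<le> ?d * norm v" by (intro mult_right_mono) auto
      ultimately show "norm (z - x) \<le> (1 + norm v + M2) * ?d"
        using norm_triangle_ineq[of "y - x" "e - s *\<^sub>R v"] norm_triangle_ineq4[of e "s *\<^sub>R v"] e y
        unfolding zx by (simp add: distrib_right mult.commute)
    qed (use \<open>\<sigma> \<ge> 0\<close> in auto)
    finally have "\<zeta> \<bullet> (z - x) \<le> \<sigma> * (1 + norm v + M2)\<^sup>2 * ?d\<^sup>2"
      by (simp add: power_mult_distrib)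
    moreover have "\<zeta> \<bullet> (z - x) = \<zeta> \<bullet> (y - x) + \<zeta> \<bullet> e - \<mu> * s"
      unfolding zx by (simp add: \<mu>_def inner_add_right inner_diff_right)
    moreover have "- (\<zeta> \<bullet> e) \<le> norm \<zeta> * M2 * ?d\<^sup>2"
    proof -
      have "- (\<zeta> \<bullet> e) \<le> norm \<zeta> * norm e" using Cauchy_Schwarz_ineq2[of \<zeta> e] by linarith
      also have "\<dots> \<le> norm \<zeta> * (M2 * s * ?d)" using e by (intro mult_left_mono) auto
      also have "\<dots> \<le> norm \<zeta> * (M2 * ?d * ?d)"
        using y \<open>M2 > 0\<close> by (intro mult_left_mono mult_right_mono) auto
      also have "\<dots> = norm \<zeta> * M2 * ?d\<^sup>2" by (simp add: power2_eq_square)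
      finally show ?thesis .
    qed
    ultimately show ?thesis by (simp add: C1_def distrib_right)
  qed
  have above: "\<zeta> \<bullet> (y - x) + \<mu> * s \<le> C2 * (norm (y - x) + s)\<^sup>2"
    if y: "norm (y - x) \<le> \<delta>" "0 < s" "s \<le> \<delta>" "min_time F K y \<le> ereal (r + s)" for y s
  proof (cases "min_time F K y \<le> ereal r")
    case True
    have "\<zeta> \<bullet> (y - x) + \<mu> * s \<le> \<zeta> \<bullet> (y - x)"
      using \<open>\<mu> \<le> 0\<close> y by (simp add: mult_nonpos_nonneg)
    also have "\<dots> \<le> \<sigma> * (norm (y - x))\<^sup>2" using \<sigma>[OF True] .
    also have "\<dots> \<le> C2 * (norm (y - x) + s)\<^sup>2"
      using \<open>\<sigma> \<le> C2\<close> \<open>\<sigma> \<ge> 0\<close> y by (intro mult_mono power_mono) auto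
    finally show ?thesis .
  next
    case False
    let ?d = "norm (y - x) + s"
    \<comment> \<open>The extra \<open>s\<^sup>2\<close> absorbs the gap between a nearly optimal
      arrival time and the infimum, so the level \<open>r\<close> is reached by time
      \<open>s'\<close>.\<close>
    define s' where "s' = s + s\<^sup>2"
    have "s\<^sup>2 \<le> s * 1" using y \<delta> unfolding power2_eq_square by (intro mult_left_mono) auto
    then have s': "0 < s'" "s' \<le> 2 * s" "s' \<le> \<delta>1" "s' \<le> r"
      using y \<delta> by (auto simp: s'_def add_pos_nonneg)
    have "norm (y - x) + s' \<le> 2 * norm (y - x) + 2 * s"
      by (intro add_mono s'(2)) simp
    then have s'_le: "norm (y - x) + s' \<le> 2 * ?d" "s' \<le> 2 * ?d"
      using s'(2) by (simp_all add: add_increasing)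
    have "r + s < r + s'" using y by (simp add: s'_def)
    then obtain T Y where Y: "T \<ge> 0" "T < r + s'" "trajectory F y T Y" "Y T \<in> K"
      using y(4) unfolding min_time_le_iff by blast
    have "\<not> T < r"
    proof
      assume "T < r"
      then have "min_time F K y < ereal r" using Y min_time_less_iff[of F K y r] by blast
      then show False using False by simp
    qed
    then have "s' \<le> T" using s' by simp
    have "min_time F K (Y s') \<le> ereal (T - s')"
      using min_time_along[OF Y(3,4)] s' \<open>s' \<le> T\<close> by simp
    also have "\<dots> \<le> ereal r" using Y(2) by simp
    finally have "\<zeta> \<bullet> (Y s' - x) \<le> \<sigma> * (norm (Y s' - x))\<^sup>2" by (rule \<sigma>)
    also have "\<dots> \<le> \<sigma> * ((1 + 2 * M1) * ?d)\<^sup>2"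
    proof (intro mult_left_mono power_mono)
      have "norm (Y s' - y) \<le> M1 * s'"
        using near[OF _ Y(3), of s'] y \<delta> s' \<open>s' \<le> T\<close> by simp
      also have "\<dots> \<le> M1 * (2 * ?d)"
        using s'_le(2) \<open>M1 > 0\<close> by (intro mult_left_mono) auto
      finally show "norm (Y s' - x) \<le> (1 + 2 * M1) * ?d"
        using norm_triangle_ineq[of "Y s' - y" "y - x"] y by (simp add: algebra_simps)
    qed (use \<open>\<sigma> \<ge> 0\<close> in auto)
    finally have 1: "\<zeta> \<bullet> (Y s' - x) \<le> \<sigma> * (1 + 2 * M1)\<^sup>2 * ?d\<^sup>2"
      by (simp add: power_mult_distrib)
    have 2: "(\<mu> - norm \<zeta> * M1 * (norm (y - x) + s')) * s' \<le> \<zeta> \<bullet> (Y s' - y)"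
      using growth[OF _ Y(3), of s' \<mu> \<zeta>] y \<delta> s' \<open>s' \<le> T\<close> v_min by (simp add: \<mu>_def)
    have 3: "norm \<zeta> * M1 * (norm (y - x) + s') * s' \<le> norm \<zeta> * M1 * 4 * ?d\<^sup>2"
    proof -
      have "(norm (y - x) + s') * s' \<le> (2 * ?d) * (2 * ?d)"
        using s'_le s'(1) y by (intro mult_mono) auto
      then have "norm \<zeta> * M1 * ((norm (y - x) + s') * s') \<le> norm \<zeta> * M1 * ((2 * ?d) * (2 * ?d))"
        using \<open>M1 > 0\<close> by (intro mult_left_mono) auto
      then show ?thesis by (simp add: power2_eq_square algebra_simps)
    qed
    have 4: "- \<mu> * s\<^sup>2 \<le> \<bar>\<mu>\<bar> * ?d\<^sup>2"
      using y by (intro mult_mono power_mono) auto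
    have "\<zeta> \<bullet> (Y s' - x) = \<zeta> \<bullet> (Y s' - y) + \<zeta> \<bullet> (y - x)"
      by (simp add: inner_diff_right)
    moreover have "\<mu> * s' = \<mu> * s + \<mu> * s\<^sup>2" by (simp add: s'_def distrib_left)
    ultimately have "\<zeta> \<bullet> (y - x) + \<mu> * s \<le> \<sigma> * (1 + 2 * M1)\<^sup>2 * ?d\<^sup>2 + norm \<zeta> * M1 * 4 * ?d\<^sup>2 + \<bar>\<mu>\<bar> * ?d\<^sup>2"
      using 1 2 3 4 by (simp add: left_diff_distrib)
    then show ?thesis by (simp add: C2_def distrib_right)
  qed
  define C where "C = max C1 C2"
  show ?thesis
    unfolding \<mu>_def[symmetric]
  proof (rule proximal_normal_coneI_local[OF \<open>\<delta> > 0\<close>])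
    fix p assume p: "p \<in> ereal_epigraph (min_time F K)" "norm (p - (x, r)) < \<delta>"
    obtain y \<beta> where p_eq: "p = (y, \<beta>)" by (cases p)
    have T: "min_time F K y \<le> ereal \<beta>" using p(1) by (simp add: ereal_epigraph_def p_eq)
    let ?s = "\<bar>\<beta> - r\<bar>"
    have d: "norm (y - x) \<le> \<delta>" "?s \<le> \<delta>"
      using p(2) norm_fst_le[of "y - x" "\<beta> - r"] norm_snd_le[of "\<beta> - r" "y - x"] by (auto simp: p_eq)
    have "\<zeta> \<bullet> (y - x) + \<mu> * (\<beta> - r) \<le> C * (norm (y - x) + ?s)\<^sup>2"
    proof (cases "\<beta> \<le> r")
      case True
      then have "\<zeta> \<bullet> (y - x) + \<mu> * (\<beta> - r) \<le> C1 * (norm (y - x) + ?s)\<^sup>2"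
        using below[of y "r - \<beta>"] d T by (simp add: algebra_simps)
      also have "\<dots> \<le> C * (norm (y - x) + ?s)\<^sup>2"
        by (intro mult_right_mono) (auto simp: C_def)
      finally show ?thesis .
    next
      case False
      then have "\<zeta> \<bullet> (y - x) + \<mu> * (\<beta> - r) \<le> C2 * (norm (y - x) + ?s)\<^sup>2"
        using above[of y "\<beta> - r"] d T by simp
      also have "\<dots> \<le> C * (norm (y - x) + ?s)\<^sup>2"
        by (intro mult_right_mono) (auto simp: C_def)
      finally show ?thesis .
    qed
    \<comment> \<open>Conversion from the sum of the two distances to the Euclidean norm of the
      product; hence the final factor 2.\<close>
    also have "\<dots> \<le> C * (2 * ((norm (y - x))\<^sup>2 + ?s\<^sup>2))"
    proof (rule mult_left_mono)
      show "(norm (y - x) + ?s)\<^sup>2 \<le> 2 * ((norm (y - x))\<^sup>2 + ?s\<^sup>2)"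
        using sum_squares_bound[of "norm (y - x)" ?s] by (simp add: power2_sum)
    qed (use \<open>C1 \<ge> 0\<close> in \<open>simp add: C_def\<close>)
    finally show "(\<zeta>, \<mu>) \<bullet> (p - (x, r)) \<le> 2 * C * (norm (p - (x, r)))\<^sup>2"
      by (simp add: p_eq norm_Pair algebra_simps)
  qed
qed

theorem theorem3p8:
  fixes F :: "real ^ 'n \<Rightarrow> (real ^ 'n) set" and K :: "(real ^ 'n) set" and x :: "real ^ 'n"
  assumes "assumption_F F"
    and "closed K"
    and "x \<in> controllable_set F K - K"
  shows "dim (proximal_normal_cone
                (controllable_set_upto F K (real_of_ereal (min_time F K x))) x)
       = dim (proximal_normal_cone
                (ereal_epigraph (min_time F K)) (x, real_of_ereal (min_time F K x)))"
proof -
  define r where "r = real_of_ereal (min_time F K x)"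
  have "0 < min_time F K x" using min_time_pos assms by blast
  moreover have "min_time F K x < \<infinity>" using assms(3) by (simp add: controllable_set_def)
  ultimately have r: "min_time F K x = ereal r" "r > 0"
    unfolding r_def by (cases "min_time F K x"; simp)+
  let ?R = "proximal_normal_cone (controllable_set_upto F K r) x"
  let ?E = "proximal_normal_cone (ereal_epigraph (min_time F K)) (x, r)"
  have "?R = fst ` ?E"
  proof
    show "fst ` ?E \<subseteq> ?R" using fst_proximal_normal_epigraph[OF r(1)] by auto
    show "?R \<subseteq> fst ` ?E"
    proof
      fix \<zeta> assume \<zeta>: "\<zeta> \<in> ?R"
      have "compact (F x)" "F x \<noteq> {}" using assms(1) by (auto simp: assumption_F_def)
      moreover have "continuous_on (F x) (\<lambda>v. \<zeta> \<bullet> v)" by (intro continuous_intros)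
      ultimately obtain v where v: "v \<in> F x" "\<And>u. u \<in> F x \<Longrightarrow> \<zeta> \<bullet> v \<le> \<zeta> \<bullet> u"
        using continuous_attains_inf by metis
      from sublevel_normal_lifts[OF assms(1) r \<zeta> v] show "\<zeta> \<in> fst ` ?E" by force
    qed
  qed
  moreover have "dim (fst ` ?E) = dim ?E"
  proof (rule dim_fst_image_convex_cone)
    \<comment> \<open>The component \<open>a\<close> is a lower bound of
      \<open>\<zeta> \<bullet> v\<close> over \<open>F x\<close>, and \<open>b\<close> dominates all
      such lower bounds. Exchanging the roles gives equality.\<close>
    have "a \<le> b" if "(\<zeta>, a) \<in> ?E" "(\<zeta>, b) \<in> ?E" for \<zeta> a b
      using epigraph_normal_ge[OF assms(1) r that(2)] epigraph_normal_le[OF assms(1) r(1) that(1)]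
      by blast
    then show "a = b" if "(\<zeta>, a) \<in> ?E" "(\<zeta>, b) \<in> ?E" for \<zeta> a b
      using that by (meson order_antisym)
  qed (auto intro: zero_in_proximal_normal_cone proximal_normal_cone_add proximal_normal_cone_scaleR)
  ultimately show ?thesis unfolding r_def by simp
qed

end
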